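(* Let $P$ be a finite ordered set that is not totally ordered and whose cover graph is a forest. Then $P$ has a very good pair, and hence has a balanced pair.
   Context: For $x,y$ in an ordered set, $y$ covers $x$ if $x<y$ and no $z$ satisfies $x<z<y$. The cover graph of $P=(V,\leq)$ is the graph on $V$ with $\{x,y\}$ an edge iff one of $x,y$ covers the other. For $u\in V$, $D(u)=\{v: v<u\}$ and $U(u)=\{v: u<v\}$. The dual $P^*$ reverses the order. A pair $(a,b)$ is very good if the following hold simultaneously in $P$ or simultaneously in $P^*$: (i) $D(a)=D(b)$; (ii) $U(a)\setminus U(b)$ and $U(b)\setminus U(a)$ are chains (possibly empty). A pair $(x,y)$ is balanced if $1/3\leq\mathbb{P}(x\prec y)\leq 2/3$, where $\mathbb{P}(x\prec y)$ is the proportion of linear extensions of $P$ putting $x$ before $y$. *)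

theory Defs
  imports Complex_Main
begin

(* An ordered set P is a carrier V with a reflexive order r such that partial_order_on V r;
   its dual is r\<inverse>. The strict down-set D(u) is underS r u, the strict up-set U(u) is
   aboveS r u, and C is a chain iff C \<in> Chains r. *)

definition covers :: "'a rel \<Rightarrow> 'a \<Rightarrow> 'a \<Rightarrow> bool" where
  "covers r y x \<longleftrightarrow> (x, y) \<in> r - Id \<and> (\<nexists>z. (x, z) \<in> r - Id \<and> (z, y) \<in> r - Id)"

definition cover_edges :: "'a set \<Rightarrow> 'a rel \<Rightarrow> 'a set set" where
  "cover_edges V r = {{x, y} |x y. x \<in> V \<and> y \<in> V \<and> (covers r x y \<or> covers r y x)}"

(* The list c enumerates the vertices of a cycle of the simple graph (V, E), without
   repeating the first vertex at the end. *)
definition graph_cycle :: "'a set \<Rightarrow> 'a set set \<Rightarrow> 'a list \<Rightarrow> bool" where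
  "graph_cycle V E c \<longleftrightarrow> 3 \<le> length c \<and> distinct c \<and> set c \<subseteq> V \<and>
     (\<forall>i < length c. {c ! i, c ! (Suc i mod length c)} \<in> E)"

definition forest :: "'a set \<Rightarrow> 'a set set \<Rightarrow> bool" where
  "forest V E \<longleftrightarrow> (\<nexists>c. graph_cycle V E c)"

definition very_good_in :: "'a rel \<Rightarrow> 'a \<Rightarrow> 'a \<Rightarrow> bool" where
  "very_good_in r a b \<longleftrightarrow> underS r a = underS r b \<and>
     aboveS r a - aboveS r b \<in> Chains r \<and> aboveS r b - aboveS r a \<in> Chains r"

(* Distinctness is essential: every (a, a) satisfies very_good_in. *)
definition very_good_pair :: "'a set \<Rightarrow> 'a rel \<Rightarrow> 'a \<Rightarrow> 'a \<Rightarrow> bool" where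
  "very_good_pair V r a b \<longleftrightarrow> a \<in> V \<and> b \<in> V \<and> a \<noteq> b \<and>
     (very_good_in r a b \<or> very_good_in (r\<inverse>) a b)"

definition linear_extensions :: "'a set \<Rightarrow> 'a rel \<Rightarrow> 'a rel set" where
  "linear_extensions V r = {L. linear_order_on V L \<and> r \<subseteq> L}"

definition prob_before :: "'a set \<Rightarrow> 'a rel \<Rightarrow> 'a \<Rightarrow> 'a \<Rightarrow> real" where
  "prob_before V r x y =
     real (card {L \<in> linear_extensions V r. (x, y) \<in> L - Id}) / real (card (linear_extensions V r))"

definition balanced_pair :: "'a set \<Rightarrow> 'a rel \<Rightarrow> 'a \<Rightarrow> 'a \<Rightarrow> bool" where
  "balanced_pair V r x y \<longleftrightarrow> x \<in> V \<and> y \<in> V \<and> x \<noteq> y \<and>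
     1 / 3 \<le> prob_before V r x y \<and> prob_before V r x y \<le> 2 / 3"

end

theory Submission
  imports Defs "HOL-Combinatorics.Transposition"
begin

text \<open>
  A very good pair \<open>(a, b)\<close> with \<open>D(a) = D(b)\<close>, where \<open>a\<close> precedes \<open>b\<close> in at most half of the linear
  extensions, gives a balanced pair by Linial's argument: let \<open>b = c\<^sub>0 < c\<^sub>1 < \<dots>\<close> be the chain
  \<open>{b} \<union> (U(b) - U(a))\<close>. Transposing \<open>a\<close> and \<open>c\<^sub>i\<close> shows that \<open>a\<close> falls between \<open>c\<^sub>i\<close> and \<open>c\<^sub>i\<^sub>+\<^sub>1\<close> at
  most as often as between \<open>c\<^sub>i\<^sub>-\<^sub>1\<close> and \<open>c\<^sub>i\<close>. So the probability that \<open>a\<close> precedes \<open>c\<^sub>i\<close> grows with \<open>i\<close>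
  in steps bounded by its first value and cannot jump over the middle third.

  For the existence of a very good pair, suppose there is none. A minimal element with a chain above
  it and a maximal element with a chain below it are then each unique, if they exist. By induction,
  every branch of the forest is a straight chain or contains one of these two elements. Hence there
  is, up to duality, such a minimal element \<open>m\<close>; if \<open>P\<close> is not linear then exactly one edge \<open>x > c\<close>
  leaves the chain above \<open>m\<close>, and behind it lies the maximal element \<open>t\<close>. All branches off the path
  from \<open>m\<close> to \<open>t\<close> are straight, and inspecting how the path continues from \<open>c\<close> produces a very good
  pair.
\<close>

subsection \<open>Branches of a cover graph that is a forest\<close>

definition adj :: "'a rel \<Rightarrow> 'a \<Rightarrow> 'a \<Rightarrow> bool" where
  "adj r x y \<longleftrightarrow> covers r x y \<or> covers r y x"

text \<open>For \<open>x \<noteq> c\<close> this is the component of \<open>x\<close> in the cover graph with \<open>c\<close> deleted.\<close>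

definition branch :: "'a rel \<Rightarrow> 'a \<Rightarrow> 'a \<Rightarrow> 'a set" where
  "branch r c x = {v. (\<lambda>p q. adj r p q \<and> p \<noteq> c \<and> q \<noteq> c)\<^sup>*\<^sup>* x v}"

text \<open>Meant for \<open>x\<close> covered by \<open>c\<close>; for \<open>x\<close> covering \<open>c\<close> use \<open>straight (r\<inverse>) c x\<close>.\<close>

definition straight :: "'a rel \<Rightarrow> 'a \<Rightarrow> 'a \<Rightarrow> bool" where
  "straight r c x \<longleftrightarrow> branch r c x \<in> Chains r \<and> (\<forall>p\<in>branch r c x. (p, x) \<in> r)"

definition chain_bottom :: "'a set \<Rightarrow> 'a rel \<Rightarrow> 'a \<Rightarrow> bool" where
  "chain_bottom V r m \<longleftrightarrow> m \<in> V \<and> underS r m = {} \<and> aboveS r m \<in> Chains r"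

text \<open>Self-dual, so that the induction over branches can exclude both kinds of ends at
  once.\<close>

definition chain_end :: "'a set \<Rightarrow> 'a rel \<Rightarrow> 'a \<Rightarrow> bool" where
  "chain_end V r m \<longleftrightarrow> chain_bottom V r m \<or> chain_bottom V (r\<inverse>) m"

lemma covers_converse [simp]: "covers (r\<inverse>) x y = covers r y x"
  by (auto simp: covers_def)

lemma adj_converse [simp]: "adj (r\<inverse>) = adj r"
  by (auto simp: adj_def fun_eq_iff)

lemma adj_sym: "adj r x y \<Longrightarrow> adj r y x"
  by (auto simp: adj_def)

lemma adj_irrefl: "\<not> adj r x x"
  by (auto simp: adj_def covers_def)

lemma branch_converse [simp]: "branch (r\<inverse>) = branch r"
  by (simp add: branch_def fun_eq_iff)

lemma Chains_converse [simp]: "Chains (r\<inverse>) = Chains r"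
  by (auto simp: Chains_def)

lemma aboveS_converse [simp]: "aboveS (r\<inverse>) = underS r"
  by (auto simp: aboveS_def underS_def)

lemma underS_converse [simp]: "underS (r\<inverse>) = aboveS r"
  by (auto simp: aboveS_def underS_def)

lemma above_converse [simp]: "above (r\<inverse>) = under r"
  by (auto simp: above_def under_def)

lemma under_converse [simp]: "under (r\<inverse>) = above r"
  by (auto simp: above_def under_def)

lemma chain_end_converse [simp]: "chain_end V (r\<inverse>) = chain_end V r"
  by (auto simp: chain_end_def)

lemma cover_edges_converse [simp]: "cover_edges V (r\<inverse>) = cover_edges V r"
  by (auto simp: cover_edges_def)

lemma very_good_pair_converse [simp]: "very_good_pair V (r\<inverse>) = very_good_pair V r"
  by (auto simp: very_good_pair_def fun_eq_iff)

lemma very_good_pairI: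
  assumes "a \<in> V" "b \<in> V" "a \<noteq> b" "underS r a = underS r b"
    "aboveS r a - aboveS r b \<in> Chains r" "aboveS r b - aboveS r a \<in> Chains r"
  shows "very_good_pair V r a b"
  using assms by (auto simp: very_good_pair_def very_good_in_def)

lemma very_good_pair_dualI:
  assumes "a \<in> V" "b \<in> V" "a \<noteq> b" "aboveS r a = aboveS r b"
    "underS r a - underS r b \<in> Chains r" "underS r b - underS r a \<in> Chains r"
  shows "very_good_pair V r a b"
  using assms by (auto simp: very_good_pair_def very_good_in_def)

lemma Chains_subset_mono: "A \<in> Chains r \<Longrightarrow> B \<subseteq> A \<Longrightarrow> B \<in> Chains r"
  by (auto simp: Chains_def)

lemma ChainsI: "(\<And>p q. p \<in> S \<Longrightarrow> q \<in> S \<Longrightarrow> (p, q) \<in> r \<or> (q, p) \<in> r) \<Longrightarrow> S \<in> Chains r"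
  by (auto simp: Chains_def)

lemma Chains_Un:
  assumes "A \<in> Chains r" "B \<in> Chains r" "\<And>p q. p \<in> A \<Longrightarrow> q \<in> B \<Longrightarrow> (p, q) \<in> r"
  shows "A \<union> B \<in> Chains r"
  using assms by (auto simp: Chains_def)

text \<open>A vertex prepended to a walk that already contains it cuts the walk back to the suffix
  starting there. Connectivity thus yields the repetition-free walks from which cycles are
  built.\<close>

lemma rtranclp_imp_distinct_walk:
  assumes "R\<^sup>*\<^sup>* a b"
  shows "\<exists>xs. xs \<noteq> [] \<and> distinct xs \<and> hd xs = a \<and> last xs = b \<and> successively R xs"
  using assms
proof (induction rule: converse_rtranclp_induct)
  case base
  show ?case by (rule exI[of _ "[b]"]) simp
next
  case (step y z)
  then obtain xs where xs: "xs \<noteq> []" "distinct xs" "hd xs = z" "last xs = b" "successively R xs"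
    by blast
  show ?case
  proof (cases "y \<in> set xs")
    case False
    with xs step(1) show ?thesis
      by (intro exI[of _ "y # xs"]) (auto simp: successively_Cons)
  next
    case True
    then obtain ps qs where "xs = ps @ y # qs" by (auto simp: in_set_conv_decomp)
    with xs show ?thesis
      by (intro exI[of _ "y # qs"]) (auto simp: successively_append_iff)
  qed
qed

section \<open>Covers and order relations in a finite order\<close>

locale forest_order =
  fixes V :: "'a set" and r :: "'a rel"
  assumes finite_V: "finite V" and order: "partial_order_on V r"
    and forest: "forest V (cover_edges V r)"
begin

abbreviation le (infix "\<sqsubseteq>" 50) where "a \<sqsubseteq> b \<equiv> (a, b) \<in> r"

lemma dual: "forest_order V (r\<inverse>)"
  using finite_V order forest by (simp add: forest_order_def)

lemma refl: "a \<in> V \<Longrightarrow> a \<sqsubseteq> a"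
  using order by (auto simp: order_on_defs refl_on_def)

lemma trans: "a \<sqsubseteq> b \<Longrightarrow> b \<sqsubseteq> c \<Longrightarrow> a \<sqsubseteq> c"
  using order by (auto simp: order_on_defs elim: transE)

lemma antisym: "a \<sqsubseteq> b \<Longrightarrow> b \<sqsubseteq> a \<Longrightarrow> a = b"
  using order by (auto simp: order_on_defs elim: antisymD)

lemma le_V: "a \<sqsubseteq> b \<Longrightarrow> a \<in> V" "a \<sqsubseteq> b \<Longrightarrow> b \<in> V"
  using order by (auto simp: order_on_defs)

lemma covers_le: "covers r y x \<Longrightarrow> x \<sqsubseteq> y"
  by (auto simp: covers_def)

lemma covers_neq: "covers r y x \<Longrightarrow> x \<noteq> y"
  by (auto simp: covers_def)

lemma covers_not_le: "covers r y x \<Longrightarrow> \<not> y \<sqsubseteq> x"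
  using antisym by (auto simp: covers_def)

lemma covers_between: "covers r y x \<Longrightarrow> x \<sqsubseteq> z \<Longrightarrow> z \<sqsubseteq> y \<Longrightarrow> z = x \<or> z = y"
  by (auto simp: covers_def)

lemma adj_V: "adj r x y \<Longrightarrow> x \<in> V" "adj r x y \<Longrightarrow> y \<in> V"
  unfolding adj_def by (blast dest: covers_le le_V)+

lemma finite_r: "finite r"
  using finite_V order by (auto simp: order_on_defs intro: finite_subset)

lemma ex_minimal:
  assumes "a \<in> A"
  shows "\<exists>m\<in>A. \<forall>z\<in>A. z \<sqsubseteq> m \<longrightarrow> z = m"
proof -
  have "wf (r - Id)"
    using order finite_r by (metis partial_order_on_well_order_on)
  from wfE_min[OF this assms] obtain m where "m \<in> A" "\<And>y. (y, m) \<in> r - Id \<Longrightarrow> y \<notin> A"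
    by blast
  then show ?thesis by (intro bexI[of _ m]) auto
qed

lemma ex_maximal:
  assumes "a \<in> A"
  shows "\<exists>m\<in>A. \<forall>z\<in>A. m \<sqsubseteq> z \<longrightarrow> z = m"
  using forest_order.ex_minimal[OF dual assms] by simp

lemma ex_cover_up:
  assumes "a \<sqsubseteq> b" "a \<noteq> b"
  shows "\<exists>q. covers r q a \<and> q \<sqsubseteq> b"
proof -
  have "b \<in> {q. a \<sqsubseteq> q \<and> a \<noteq> q \<and> q \<sqsubseteq> b}"
    using assms le_V refl by auto
  from ex_minimal[OF this] obtain q where q: "a \<sqsubseteq> q" "a \<noteq> q" "q \<sqsubseteq> b"
    and min: "\<And>z. a \<sqsubseteq> z \<Longrightarrow> a \<noteq> z \<Longrightarrow> z \<sqsubseteq> b \<Longrightarrow> z \<sqsubseteq> q \<Longrightarrow> z = q" by auto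
  have "covers r q a"
    unfolding covers_def using q min trans[OF _ q(3)] by blast
  with q show ?thesis by blast
qed

lemma ex_cover_down: "a \<sqsubseteq> b \<Longrightarrow> a \<noteq> b \<Longrightarrow> \<exists>q. covers r b q \<and> a \<sqsubseteq> q"
  using forest_order.ex_cover_up[OF dual, of b a] by auto

text \<open>A maximal element of \<open>S\<close> between \<open>a\<close> and \<open>b\<close> has
  a cover below \<open>b\<close>, which is outside \<open>S\<close>. This is how an order relation
  that leaves a set is turned into a cover edge that leaves it.\<close>

lemma crossing:
  assumes "a \<in> S" "b \<notin> S" "a \<sqsubseteq> b"
  shows "\<exists>p q. p \<in> S \<and> q \<notin> S \<and> a \<sqsubseteq> p \<and> covers r q p \<and> q \<sqsubseteq> b"
proof -
  have "a \<in> {p\<in>S. a \<sqsubseteq> p \<and> p \<sqsubseteq> b}"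
    using assms le_V refl by auto
  from ex_maximal[OF this] obtain p where p: "p \<in> S" "a \<sqsubseteq> p" "p \<sqsubseteq> b"
    and max: "\<And>z. z \<in> S \<Longrightarrow> a \<sqsubseteq> z \<Longrightarrow> z \<sqsubseteq> b \<Longrightarrow> p \<sqsubseteq> z \<Longrightarrow> z = p" by auto
  from p assms obtain q where q: "covers r q p" "q \<sqsubseteq> b"
    using ex_cover_up by blast
  have "q \<notin> S"
    using max[of q] q p trans covers_le covers_neq by blast
  with p q show ?thesis by blast
qed

text \<open>A repetition-free walk from \<open>y\<close> to \<open>y'\<close> avoiding
  \<open>c\<close> would close up through \<open>c\<close> to a cycle. All further consequences of
  acyclicity are drawn from this one.\<close>

lemma not_both_neighbours_in_branch:
  assumes "adj r c y" "adj r c y'" "y \<noteq> y'"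
  shows "y' \<notin> branch r c y"
proof
  define R where "R = (\<lambda>p q. adj r p q \<and> p \<noteq> c \<and> q \<noteq> c)"
  assume "y' \<in> branch r c y"
  then have "R\<^sup>*\<^sup>* y y'"
    by (simp add: branch_def R_def)
  from rtranclp_imp_distinct_walk[OF this] obtain xs
    where xs: "xs \<noteq> []" "distinct xs" "hd xs = y" "last xs = y'" "successively R xs"
    by (elim exE conjE)
  then obtain z zs where xs_eq: "xs = y # z # zs"
    using assms(3) by (cases xs; cases "tl xs") auto
  \<comment> \<open>Every vertex of the walk takes part in an \<open>R\<close> step: the first one
    as source, each later one as target.\<close>
  have mem: "v \<noteq> c \<and> v \<in> V" if "v \<in> set xs" for v
  proof -
    from that obtain i where i: "i < length xs" "xs ! i = v" by (auto simp: in_set_conv_nth)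
    show ?thesis
    proof (cases i)
      case 0
      with i xs(5) xs_eq show ?thesis by (auto simp: R_def dest: adj_V)
    next
      case (Suc j)
      with xs(5) i have "R (xs ! j) v" by (auto simp: successively_conv_nth)
      then show ?thesis by (auto simp: R_def dest: adj_V)
    qed
  qed
  have edge: "{p, q} \<in> cover_edges V r" if "adj r p q" for p q
    using that adj_V[OF that] by (auto simp: cover_edges_def adj_def)
  have "graph_cycle V (cover_edges V r) (c # xs)"
    unfolding graph_cycle_def
  proof (intro conjI allI impI)
    show "3 \<le> length (c # xs)" using xs_eq by simp
    show "distinct (c # xs)" using xs mem by auto
    show "set (c # xs) \<subseteq> V" using mem adj_V[OF assms(1)] by auto
  next
    fix i assume i: "i < length (c # xs)"
    show "{(c # xs) ! i, (c # xs) ! (Suc i mod length (c # xs))} \<in> cover_edges V r"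
    proof (cases "i = length xs")
      case True
      then have "(c # xs) ! i = y'"
        using xs by (simp add: last_conv_nth nth_Cons')
      with True show ?thesis using edge[OF assms(2)] by (simp add: insert_commute)
    next
      case False
      with i have *: "Suc i mod length (c # xs) = Suc i" by simp
      show ?thesis
      proof (cases i)
        case 0
        with * show ?thesis using edge[OF assms(1)] xs_eq by simp
      next
        case (Suc j)
        with False i xs(5) have "R (xs ! j) (xs ! Suc j)"
          by (auto simp: successively_conv_nth)
        then have "adj r (xs ! j) (xs ! Suc j)" by (simp add: R_def)
        from edge[OF this] * Suc show ?thesis by simp
      qed
    qed
  qed
  with forest show False by (auto simp: forest_def)
qed

section \<open>Structure of branches\<close>

lemma branch_root: "x \<in> branch r c x"
  by (simp add: branch_def)

lemma not_in_branch:
  assumes "x \<noteq> c"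
  shows "c \<notin> branch r c x"
proof
  assume "c \<in> branch r c x"
  then have "(\<lambda>p q. adj r p q \<and> p \<noteq> c \<and> q \<noteq> c)\<^sup>*\<^sup>* x c" by (simp add: branch_def)
  then show False using assms by (cases rule: rtranclp.cases) auto
qed

lemma branch_V: "x \<in> V \<Longrightarrow> branch r c x \<subseteq> V"
proof
  fix v assume "x \<in> V" "v \<in> branch r c x"
  then have "(\<lambda>p q. adj r p q \<and> p \<noteq> c \<and> q \<noteq> c)\<^sup>*\<^sup>* x v" by (simp add: branch_def)
  then show "v \<in> V" using \<open>x \<in> V\<close> by (cases rule: rtranclp.cases) (auto dest: adj_V)
qed

lemma branch_step: "p \<in> branch r c x \<Longrightarrow> adj r p q \<Longrightarrow> q \<noteq> c \<Longrightarrow> x \<noteq> c \<Longrightarrow> q \<in> branch r c x"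
  using not_in_branch[of x c] unfolding branch_def by (auto intro: rtranclp.rtrancl_into_rtrancl)

lemma branch_sym: "y \<in> branch r c x \<Longrightarrow> x \<in> branch r c y"
proof -
  have "symp (\<lambda>p q. adj r p q \<and> p \<noteq> c \<and> q \<noteq> c)" by (auto simp: symp_def adj_sym)
  then have "symp ((\<lambda>p q. adj r p q \<and> p \<noteq> c \<and> q \<noteq> c)\<^sup>*\<^sup>*)" by (rule symp_rtranclp)
  then show "y \<in> branch r c x \<Longrightarrow> x \<in> branch r c y" by (auto simp: branch_def symp_def)
qed

lemma branch_trans: "y \<in> branch r c x \<Longrightarrow> z \<in> branch r c y \<Longrightarrow> z \<in> branch r c x"
  by (auto simp: branch_def)

lemma branch_induct [consumes 1, case_names root step]:
  assumes "v \<in> branch r c x" "P x"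
    and "\<And>p q. p \<in> branch r c x \<Longrightarrow> q \<in> branch r c x \<Longrightarrow> adj r p q \<Longrightarrow> p \<noteq> c \<Longrightarrow> q \<noteq> c \<Longrightarrow> P p \<Longrightarrow> P q"
  shows "P v"
proof -
  have "(\<lambda>p q. adj r p q \<and> p \<noteq> c \<and> q \<noteq> c)\<^sup>*\<^sup>* x v" using assms(1) by (simp add: branch_def)
  then show ?thesis
  proof (induction rule: rtranclp_induct)
    case base show ?case by fact
  next
    case (step p q)
    then have "p \<in> branch r c x" "q \<in> branch r c x"
      by (auto simp: branch_def intro: rtranclp.rtrancl_into_rtrancl)
    with step assms(3) show ?case by blast
  qed
qed

lemma branch_neighbour:
  assumes "adj r c x" "adj r c y" "y \<in> branch r c x"
  shows "y = x"
  using not_both_neighbours_in_branch[OF assms(1,2)] assms(3) by blast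

text \<open>A step out of the branch can only reach \<open>c\<close>, and by acyclicity
  \<open>x\<close> is the only neighbour of \<open>c\<close> in the branch.\<close>

lemma branch_exit:
  assumes "adj r c x" "p \<in> branch r c x" "q \<notin> branch r c x" "adj r p q"
  shows "p = x \<and> q = c"
proof -
  have "q = c" using branch_step[OF assms(2,4)] assms(1,3) adj_irrefl by metis
  moreover from this have "p = x"
    using branch_neighbour[OF assms(1) _ assms(2)] adj_sym[OF assms(4)] by simp
  ultimately show ?thesis by simp
qed

text \<open>From a common vertex, walk back to \<open>u\<close> inside the second branch. The walk
  misses \<open>w\<close>, so \<open>u\<close> lies in the first branch too; then the edge from
  \<open>u\<close> to \<open>z\<close> leaves that branch and must be its only exit, from
  \<open>y\<close> to \<open>w\<close>.\<close>

lemma branch_disjoint: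
  assumes "adj r w y" "adj r z u" "z \<notin> branch r w y" "w \<notin> branch r z u" "w \<noteq> z \<or> y \<noteq> u"
  shows "branch r w y \<inter> branch r z u = {}"
proof (rule ccontr)
  assume "branch r w y \<inter> branch r z u \<noteq> {}"
  then obtain q where q: "q \<in> branch r w y" "q \<in> branch r z u" by blast
  have "u \<in> branch r z q" using branch_sym q(2) .
  then have "u \<in> branch r w y"
  proof (induction rule: branch_induct)
    case root show ?case by fact
  next
    case (step p p')
    then have "p' \<noteq> w" using q(2) branch_trans assms(4) by blast
    with step show ?case using branch_step assms(1) adj_irrefl by metis
  qed
  then show False
    using assms branch_exit[OF assms(1) _ assms(3)] adj_sym adj_irrefl by metis
qed

text \<open>Reaching \<open>c\<close> from \<open>y\<close> without passing \<open>x\<close> would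
  put two neighbours of \<open>x\<close> into one branch. The inclusion is strict because
  \<open>x\<close> is lost, which makes induction on branch size possible.\<close>

lemma branch_child_subset:
  assumes "adj r c x" "adj r x y" "y \<noteq> c"
  shows "branch r x y \<subset> branch r c x"
proof -
  have c: "c \<notin> branch r x y"
    using branch_neighbour[OF assms(2) adj_sym[OF assms(1)]] assms(3) by blast
  have "v \<in> branch r c x" if "v \<in> branch r x y" for v
    using that
  proof (induction rule: branch_induct)
    case root
    show ?case using branch_step[OF branch_root assms(2,3)] assms(1) adj_irrefl by metis
  next
    case (step p q)
    then show ?case using c branch_step assms(1) adj_irrefl by metis
  qed
  moreover have "x \<notin> branch r x y" using assms(2) not_in_branch adj_irrefl by metis
  ultimately show ?thesis using branch_root by blast
qed

lemma branch_children:
  assumes "adj r c x" "v \<in> branch r c x" "v \<noteq> x"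
  shows "\<exists>y. adj r x y \<and> y \<noteq> c \<and> v \<in> branch r x y"
proof -
  have "v = x \<or> (\<exists>y. adj r x y \<and> y \<noteq> c \<and> v \<in> branch r x y)"
    using assms(2)
  proof (induction rule: branch_induct)
    case root show ?case by simp
  next
    case (step p q)
    show ?case
    proof (cases "q = x \<or> p = x")
      case True
      then show ?thesis using step branch_root by metis
    next
      case False
      then show ?thesis using step branch_step adj_irrefl by metis
    qed
  qed
  with assms(3) show ?thesis by blast
qed

text \<open>An ascent out of the branch must use its only exit, the edge from \<open>x\<close> to
  \<open>c\<close>. As that edge goes up, no descent leaves the branch, which gives the next
  lemma.\<close>

lemma branch_up_exit:
  assumes "covers r c x" "p \<in> branch r c x" "q \<notin> branch r c x" "p \<sqsubseteq> q"
  shows "p \<sqsubseteq> x \<and> c \<sqsubseteq> q"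
  using crossing[OF assms(2-4)] branch_exit assms(1) unfolding adj_def by metis

lemma branch_down_closed:
  assumes "covers r c x" "p \<in> branch r c x" "q \<sqsubseteq> p"
  shows "q \<in> branch r c x"
proof (rule ccontr)
  assume "q \<notin> branch r c x"
  with crossing[of q "- branch r c x" p] assms obtain p1 q1 where
    "p1 \<notin> branch r c x" "q1 \<in> branch r c x" "covers r q1 p1" by auto
  then show False
    using branch_exit[of c x q1 p1] assms(1) covers_le covers_not_le unfolding adj_def by metis
qed

lemma branch_down_exit:
  assumes "covers r x c" "p \<in> branch r c x" "q \<notin> branch r c x" "q \<sqsubseteq> p"
  shows "x \<sqsubseteq> p \<and> q \<sqsubseteq> c"
  using forest_order.branch_up_exit[OF dual, of c x p q] assms by simp

lemma branch_up_closed: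
  assumes "covers r x c" "p \<in> branch r c x" "p \<sqsubseteq> q"
  shows "q \<in> branch r c x"
  using forest_order.branch_down_closed[OF dual, of c x p q] assms by simp

lemma branch_siblings_disjoint:
  assumes "adj r w y" "adj r w u" "y \<noteq> u"
  shows "branch r w y \<inter> branch r w u = {}"
  using branch_disjoint[OF assms(1,2)] assms not_in_branch adj_irrefl by metis

text \<open>Otherwise \<open>b\<close> would lie in two disjoint branches at
  \<open>a\<close>.\<close>

lemma unique_cover_below:
  assumes "covers r p a" "covers r q a" "p \<sqsubseteq> b" "q \<sqsubseteq> b"
  shows "p = q"
  using branch_siblings_disjoint[of a p q] branch_up_closed[OF assms(1) branch_root assms(3)]
    branch_up_closed[OF assms(2) branch_root assms(4)] assms(1,2)
  by (auto simp: adj_def)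

text \<open>At a maximal common lower bound of incomparable \<open>p\<close> and \<open>q\<close>,
  the covers towards \<open>p\<close> and towards \<open>q\<close> are both below \<open>b\<close>.
  Hence they coincide, against maximality.\<close>

lemma interval_chain:
  assumes "a \<sqsubseteq> p" "p \<sqsubseteq> b" "a \<sqsubseteq> q" "q \<sqsubseteq> b"
  shows "p \<sqsubseteq> q \<or> q \<sqsubseteq> p"
proof (rule ccontr)
  assume neg: "\<not> (p \<sqsubseteq> q \<or> q \<sqsubseteq> p)"
  have "a \<in> {z. z \<sqsubseteq> p \<and> z \<sqsubseteq> q}" using assms by simp
  from ex_maximal[OF this] obtain z where z: "z \<sqsubseteq> p" "z \<sqsubseteq> q"
    and max: "\<And>w. w \<sqsubseteq> p \<Longrightarrow> w \<sqsubseteq> q \<Longrightarrow> z \<sqsubseteq> w \<Longrightarrow> w = z" by auto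
  obtain p1 where p1: "covers r p1 z" "p1 \<sqsubseteq> p" using ex_cover_up[OF z(1)] z(2) neg by auto
  obtain q1 where q1: "covers r q1 z" "q1 \<sqsubseteq> q" using ex_cover_up[OF z(2)] z(1) neg by auto
  have "p1 = q1"
    using unique_cover_below[OF p1(1) q1(1) trans[OF p1(2) assms(2)] trans[OF q1(2) assms(4)]] .
  then show False using max[of p1] p1 q1 covers_le covers_neq by metis
qed

section \<open>Chains and straight branches\<close>

lemma above_Chains: "aboveS r a \<in> Chains r \<Longrightarrow> above r a \<in> Chains r"
  using refl le_V by (fastforce simp: Chains_def aboveS_def above_def)

lemma under_Chains: "underS r a \<in> Chains r \<Longrightarrow> under r a \<in> Chains r"
  using refl le_V by (fastforce simp: Chains_def underS_def under_def)

lemma aboveS_cover: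
  assumes "covers r c x" "\<And>q. covers r q x \<Longrightarrow> q = c"
  shows "aboveS r x = above r c"
proof
  show "aboveS r x \<subseteq> above r c"
  proof
    fix p assume "p \<in> aboveS r x"
    then obtain q where "covers r q x" "q \<sqsubseteq> p" using ex_cover_up unfolding aboveS_def by blast
    with assms(2) show "p \<in> above r c" unfolding above_def by blast
  qed
  show "above r c \<subseteq> aboveS r x"
    using trans[OF covers_le[OF assms(1)]] covers_not_le[OF assms(1)]
    by (auto simp: above_def aboveS_def)
qed

text \<open>Another upper cover of \<open>x\<close> would lie in the branch, whose greatest element
  is \<open>x\<close>. Straight lower branches at the same \<open>c\<close> therefore start at
  elements with equal up-sets.\<close>

lemma straight_aboveS:
  assumes "covers r c x" "straight r c x"
  shows "aboveS r x = above r c"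
proof (rule aboveS_cover[OF assms(1)])
  fix q assume q: "covers r q x"
  show "q = c"
  proof (rule ccontr)
    assume "q \<noteq> c"
    then have "q \<in> branch r c x"
      using branch_step[OF branch_root, of x q c] q covers_neq[OF assms(1)] by (auto simp: adj_def)
    then show False using assms(2) covers_not_le[OF q] by (auto simp: straight_def)
  qed
qed

lemma straight_underS:
  assumes "covers r c x" "straight r c x"
  shows "underS r x \<in> Chains r"
proof -
  have "underS r x \<subseteq> branch r c x"
    using branch_down_closed[OF assms(1) branch_root] by (auto simp: underS_def)
  then show ?thesis using assms(2) Chains_subset_mono unfolding straight_def by blast
qed

text \<open>A minimal element of the branch is minimal in the whole order, as the branch is closed
  downwards, and an ascent from it leaves the branch only through \<open>c\<close>. Stacking the
  branch below a chain above \<open>c\<close> makes it a chain bottom, a competitor to any other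
  one.\<close>

lemma straight_bottom:
  assumes "covers r c x" "straight r c x"
  shows "\<exists>e. e \<in> branch r c x \<and> e \<in> V \<and> underS r e = {} \<and>
    (\<forall>q. e \<sqsubseteq> q \<longrightarrow> q \<in> branch r c x \<or> c \<sqsubseteq> q) \<and>
    (above r c \<in> Chains r \<longrightarrow> chain_bottom V r e)"
proof -
  from ex_minimal[OF branch_root] obtain e where e: "e \<in> branch r c x"
    and min: "\<And>z. z \<in> branch r c x \<Longrightarrow> z \<sqsubseteq> e \<Longrightarrow> z = e" by meson
  have V: "e \<in> V" using branch_V[of x c] e le_V covers_le assms(1) by blast
  have under: "underS r e = {}"
    using min branch_down_closed[OF assms(1) e] by (auto simp: underS_def)
  have up: "q \<in> branch r c x \<or> c \<sqsubseteq> q" if "e \<sqsubseteq> q" for q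
    using branch_up_exit[OF assms(1) e _ that] by blast
  have "chain_bottom V r e" if "above r c \<in> Chains r"
  proof -
    have "branch r c x \<union> above r c \<in> Chains r"
    proof (rule Chains_Un)
      show "branch r c x \<in> Chains r" using assms(2) by (simp add: straight_def)
      show "above r c \<in> Chains r" by fact
      fix p q assume "p \<in> branch r c x" "q \<in> above r c"
      then have "p \<sqsubseteq> x" "c \<sqsubseteq> q" using assms(2) by (auto simp: straight_def above_def)
      then show "p \<sqsubseteq> q" using trans covers_le[OF assms(1)] by blast
    qed
    moreover have "aboveS r e \<subseteq> branch r c x \<union> above r c"
      using up by (auto simp: aboveS_def above_def)
    ultimately show ?thesis using V under Chains_subset_mono by (auto simp: chain_bottom_def)
  qed
  with e V under up show ?thesis by blast
qed

lemma branch_reachable: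
  assumes "adj r c x" "v \<in> branch r c x"
  shows "(adj r)\<^sup>*\<^sup>* c v"
  using assms(2)
proof (induction rule: branch_induct)
  case root
  show ?case using assms(1) by blast
next
  case (step p q)
  then show ?case by (auto intro: rtranclp.rtrancl_into_rtrancl)
qed

lemma ex_branching_above:
  assumes "a \<in> V" "above r a \<notin> Chains r"
  shows "\<exists>z u u'. a \<sqsubseteq> z \<and> covers r u z \<and> covers r u' z \<and> u \<noteq> u'"
proof -
  obtain p q where pq: "a \<sqsubseteq> p" "a \<sqsubseteq> q" "\<not> p \<sqsubseteq> q" "\<not> q \<sqsubseteq> p"
    using assms(2) by (auto simp: Chains_def above_def)
  have "a \<in> {z. a \<sqsubseteq> z \<and> z \<sqsubseteq> p \<and> z \<sqsubseteq> q}" using assms refl pq by simp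
  from ex_maximal[OF this] obtain z where z: "a \<sqsubseteq> z" "z \<sqsubseteq> p" "z \<sqsubseteq> q"
    and max: "\<And>w. a \<sqsubseteq> w \<Longrightarrow> w \<sqsubseteq> p \<Longrightarrow> w \<sqsubseteq> q \<Longrightarrow> z \<sqsubseteq> w \<Longrightarrow> w = z" by auto
  obtain u where u: "covers r u z" "u \<sqsubseteq> p" using ex_cover_up[OF z(2)] z(3) pq by auto
  obtain u' where u': "covers r u' z" "u' \<sqsubseteq> q" using ex_cover_up[OF z(3)] z(2) pq by auto
  have "u \<noteq> u'"
    using max[OF trans[OF z(1) covers_le[OF u(1)]] u(2) _ covers_le[OF u(1)]] u' covers_neq[OF u(1)]
    by blast
  with z u u' show ?thesis by blast
qed

lemma ex_branching_below:
  assumes "a \<in> V" "under r a \<notin> Chains r"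
  shows "\<exists>z u u'. z \<sqsubseteq> a \<and> covers r z u \<and> covers r z u' \<and> u \<noteq> u'"
  using forest_order.ex_branching_above[OF dual, of a] assms by simp

text \<open>An ascent from \<open>a\<close> to \<open>p\<close> that leaves the down-set of
  \<open>b\<close> before reaching \<open>b\<close> does so at a vertex with one cover below
  \<open>b\<close> and another one not below \<open>b\<close>.\<close>

lemma comparable_if_unique_covers:
  assumes "a \<sqsubseteq> p" "a \<sqsubseteq> b"
    and unique: "\<And>z u u'. a \<sqsubseteq> z \<Longrightarrow> z \<sqsubseteq> b \<Longrightarrow> z \<noteq> b \<Longrightarrow> covers r u z \<Longrightarrow> covers r u' z \<Longrightarrow> u = u'"
  shows "p \<sqsubseteq> b \<or> b \<sqsubseteq> p"
proof (rule ccontr)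
  assume neg: "\<not> (p \<sqsubseteq> b \<or> b \<sqsubseteq> p)"
  from crossing[of a "under r b" p] assms(1,2) neg obtain z u where
    z: "z \<sqsubseteq> b" "\<not> u \<sqsubseteq> b" "a \<sqsubseteq> z" "covers r u z" "u \<sqsubseteq> p" by (auto simp: under_def)
  have "z \<noteq> b" using z neg trans[OF covers_le[OF z(4)] z(5)] by blast
  then obtain u' where "covers r u' z" "u' \<sqsubseteq> b" using ex_cover_up z(1) by blast
  with unique[OF z(3,1) \<open>z \<noteq> b\<close> z(4)] z(2) show False by blast
qed

end

subsection \<open>Existence of a very good pair\<close>

text \<open>The assumption of the proof by contradiction. It is self-dual, so each lemma proved from
  it may be applied to the reversed order.\<close>

locale no_very_good = forest_order +
  assumes no_very_good: "\<not> very_good_pair V r a b"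
begin

lemma dual_no_very_good: "no_very_good V (r\<inverse>)"
  using no_very_good dual by (simp add: no_very_good_def no_very_good_axioms_def)

text \<open>Both down-sets are empty, and the differences of the up-sets are parts of
  chains.\<close>

lemma chain_bottom_unique:
  assumes "chain_bottom V r m" "chain_bottom V r m'"
  shows "m = m'"
proof (rule ccontr)
  assume "m \<noteq> m'"
  then have "very_good_pair V r m m'"
    using assms by (intro very_good_pairI) (auto simp: chain_bottom_def intro: Chains_subset_mono)
  then show False using no_very_good by blast
qed

text \<open>Equal up-sets and chains as down-sets make a pair very good in the dual order.\<close>

lemma no_very_good_lower_siblings:
  assumes "covers r x y" "covers r x y'" "aboveS r y = above r x" "aboveS r y' = above r x"
    "underS r y \<in> Chains r" "underS r y' \<in> Chains r"
  shows "y = y'"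
proof (rule ccontr)
  assume "y \<noteq> y'"
  then have "very_good_pair V r y y'"
    using assms le_V[OF covers_le[OF assms(1)]] le_V[OF covers_le[OF assms(2)]]
    by (intro very_good_pair_dualI) (auto intro: Chains_subset_mono)
  then show False using no_very_good by blast
qed

lemma straight_unique:
  assumes "covers r x y" "covers r x y'" "straight r x y" "straight r x y'"
  shows "y = y'"
  using no_very_good_lower_siblings assms straight_aboveS straight_underS by blast

text \<open>By \<open>straight_unique\<close> there is at most one lower cover, and all elements
  strictly below \<open>x\<close> lie in its branch.\<close>

lemma under_Chains_if_straight:
  assumes "\<And>y. covers r x y \<Longrightarrow> straight r x y"
  shows "under r x \<in> Chains r"
proof (rule under_Chains, rule ChainsI)
  fix p q assume "p \<in> underS r x" "q \<in> underS r x"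
  then obtain y y' where y: "covers r x y" "p \<sqsubseteq> y" and y': "covers r x y'" "q \<sqsubseteq> y'"
    using ex_cover_down unfolding underS_def by blast
  have "y = y'" using straight_unique y(1) y'(1) assms by blast
  then have "p \<in> branch r x y" "q \<in> branch r x y"
    using branch_down_closed[OF y(1) branch_root] y y' by auto
  then show "p \<sqsubseteq> q \<or> q \<sqsubseteq> p" using assms[OF y(1)] by (auto simp: straight_def Chains_def)
qed

text \<open>The elements below \<open>x\<close> form a chain. So the straight branch at a further
  upper cover of \<open>x\<close> would have a chain end as its top, inside the branch of
  \<open>x\<close>. Hence all other neighbours of \<open>x\<close> are below it.\<close>

lemma straight_if_children_straight:
  assumes cx: "covers r c x"
    and chain_bottom: "\<And>y. covers r x y \<Longrightarrow> straight r x y"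
    and up: "\<And>y. covers r y x \<Longrightarrow> y \<noteq> c \<Longrightarrow> straight (r\<inverse>) x y"
    and no_chain_end: "\<And>t. t \<in> branch r c x \<Longrightarrow> \<not> chain_end V r t"
  shows "straight r c x"
proof -
  have chain: "under r x \<in> Chains r" using under_Chains_if_straight chain_bottom by blast
  have only: "y = c" if y: "covers r y x" for y
  proof (rule ccontr)
    assume "y \<noteq> c"
    from y have cov: "covers (r\<inverse>) x y" by simp
    obtain t where t: "t \<in> branch r x y" "chain_bottom V (r\<inverse>) t"
      using forest_order.straight_bottom[OF dual cov up[OF y \<open>y \<noteq> c\<close>]] chain by auto
    have "t \<in> branch r c x"
      using branch_child_subset[of c x y] cx y \<open>y \<noteq> c\<close> t(1) by (auto simp: adj_def)
    with no_chain_end t(2) show False by (auto simp: chain_end_def)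
  qed
  have le: "v \<sqsubseteq> x" if v: "v \<in> branch r c x" for v
  proof (cases "v = x")
    case True
    then show ?thesis using refl le_V covers_le[OF cx] by blast
  next
    case False
    then obtain y where y: "adj r x y" "y \<noteq> c" "v \<in> branch r x y"
      using branch_children[OF _ v] cx by (auto simp: adj_def)
    with only have "covers r x y" by (auto simp: adj_def)
    with chain_bottom y(3) show ?thesis using trans covers_le unfolding straight_def by blast
  qed
  then have "branch r c x \<subseteq> under r x" by (auto simp: under_def)
  with chain le show ?thesis using Chains_subset_mono unfolding straight_def by blast
qed

text \<open>Induction on the size of the branch. Both directions are proved together because a
  branch may contain edges of either direction.\<close>

lemma branch_straight_or_dual_straight:
  "adj r c x \<Longrightarrow> \<forall>t\<in>branch r c x. \<not> chain_end V r t \<Longrightarrow>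
   (covers r c x \<longrightarrow> straight r c x) \<and> (covers r x c \<longrightarrow> straight (r\<inverse>) c x)"
proof (induction "card (branch r c x)" arbitrary: c x rule: less_induct)
  case less
  have IH: "(covers r x y \<longrightarrow> straight r x y) \<and> (covers r y x \<longrightarrow> straight (r\<inverse>) x y)"
    if "adj r x y" "y \<noteq> c" for y
  proof -
    have sub: "branch r x y \<subset> branch r c x" using branch_child_subset less.prems(1) that by blast
    have "finite (branch r c x)"
      using branch_V[of x c] adj_V[OF less.prems(1)] finite_V finite_subset by blast
    then have "card (branch r x y) < card (branch r c x)" using sub by (rule psubset_card_mono)
    then show ?thesis using less.hyps[OF _ that(1)] sub less.prems(2) by blast
  qed
  have "straight r c x" if "covers r c x"
  proof (rule straight_if_children_straight[OF that])
    show "straight r x y" if "covers r x y" for y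
      using IH[of y] that \<open>covers r c x\<close> covers_le covers_not_le by (auto simp: adj_def)
    show "straight (r\<inverse>) x y" if "covers r y x" "y \<noteq> c" for y
      using IH[of y] that by (auto simp: adj_def)
    show "\<not> chain_end V r t" if "t \<in> branch r c x" for t using less.prems(2) that by blast
  qed
  moreover have "straight (r\<inverse>) c x" if xc: "covers r x c"
  proof (rule no_very_good.straight_if_children_straight[OF dual_no_very_good])
    show "covers (r\<inverse>) c x" using xc by simp
    show "straight (r\<inverse>) x y" if "covers (r\<inverse>) x y" for y
      using IH[of y] that xc covers_le covers_not_le by (auto simp: adj_def)
    show "straight ((r\<inverse>)\<inverse>) x y" if "covers (r\<inverse>) y x" "y \<noteq> c" for y
      using IH[of y] that by (auto simp: adj_def)
    show "\<not> chain_end V (r\<inverse>) t" if "t \<in> branch (r\<inverse>) c x" for t using less.prems(2) that by simp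
  qed
  ultimately show ?case by blast
qed

lemma branch_straight:
  assumes "covers r c x" "\<And>t. t \<in> branch r c x \<Longrightarrow> \<not> chain_end V r t"
  shows "straight r c x"
  using branch_straight_or_dual_straight[of c x] assms by (auto simp: adj_def)

text \<open>If no branch at \<open>v\<close> contains a chain end, then all are straight and the
  elements above \<open>v\<close> form a chain; so \<open>v\<close>, or the bottom of a lower
  branch, is a chain bottom. Reachability matters because the cover graph may be
  disconnected.\<close>

lemma ex_chain_end_reachable:
  assumes "v \<in> V"
  shows "\<exists>t. chain_end V r t \<and> (adj r)\<^sup>*\<^sup>* v t"
proof (cases "\<exists>x t. adj r v x \<and> t \<in> branch r v x \<and> chain_end V r t")
  case True
  then show ?thesis using branch_reachable by blast
next
  case False
  have chain_bottom: "straight r v y" if "covers r v y" for y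
    using branch_straight_or_dual_straight[of v y] False that by (auto simp: adj_def)
  have up: "straight (r\<inverse>) v y" if "covers (r\<inverse>) v y" for y
    using branch_straight_or_dual_straight[of v y] False that by (auto simp: adj_def)
  have chain: "above r v \<in> Chains r"
    using no_very_good.under_Chains_if_straight[OF dual_no_very_good, of v] up by simp
  show ?thesis
  proof (cases "\<exists>y. covers r v y")
    case True
    then obtain y where y: "covers r v y" by blast
    obtain e where e: "e \<in> branch r v y" "chain_bottom V r e"
      using straight_bottom[OF y chain_bottom[OF y]] chain by auto
    have "(adj r)\<^sup>*\<^sup>* v e" using branch_reachable[OF _ e(1)] y by (auto simp: adj_def)
    with e(2) show ?thesis by (auto simp: chain_end_def)
  next
    case False
    then have "underS r v = {}" using ex_cover_down unfolding underS_def by blast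
    moreover have "aboveS r v \<in> Chains r"
      using chain by (rule Chains_subset_mono) (auto simp: above_def aboveS_def)
    ultimately have "chain_bottom V r v" using assms by (simp add: chain_bottom_def)
    then show ?thesis by (auto simp: chain_end_def)
  qed
qed

text \<open>Otherwise the chain above \<open>m\<close> is a whole component, and its bottom
  \<open>m\<close> and top \<open>s\<close> are the only chain ends. But an element outside this
  component reaches a chain end without entering it.\<close>

lemma chain_bottom_leaving_edge:
  assumes m: "chain_bottom V r m" and nonlinear: "\<not> linear_order_on V r"
  shows "\<exists>x c. m \<sqsubseteq> x \<and> covers r x c \<and> \<not> m \<sqsubseteq> c"
proof (rule ccontr)
  assume "\<nexists>x c. m \<sqsubseteq> x \<and> covers r x c \<and> \<not> m \<sqsubseteq> c"
  then have closed: "m \<sqsubseteq> c" if "m \<sqsubseteq> x" "covers r x c" for x c using that by blast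
  have mV: "m \<in> V" using m by (simp add: chain_bottom_def)
  have chain: "above r m \<in> Chains r" using m above_Chains by (simp add: chain_bottom_def)
  have step: "m \<sqsubseteq> q" if "m \<sqsubseteq> p" "adj r p q" for p q
    using that(2) closed[OF that(1)] trans[OF that(1) covers_le] by (auto simp: adj_def)
  have "\<exists>v\<in>V. \<not> m \<sqsubseteq> v"
  proof (rule ccontr)
    assume "\<not> (\<exists>v\<in>V. \<not> m \<sqsubseteq> v)"
    then have "linear_order_on V r"
      using chain order by (auto simp: linear_order_on_def total_on_def Chains_def above_def)
    with nonlinear show False by blast
  qed
  then obtain v where v: "v \<in> V" "\<not> m \<sqsubseteq> v" by blast
  from ex_chain_end_reachable[OF v(1)] obtain t where t: "chain_end V r t" "(adj r)\<^sup>*\<^sup>* v t" by blast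
  from t(2) have mt: "\<not> m \<sqsubseteq> t"
  proof (induction rule: rtranclp_induct)
    case base
    show ?case by (fact v(2))
  next
    case (step p q)
    then show ?case using \<open>\<And>p q. m \<sqsubseteq> p \<Longrightarrow> adj r p q \<Longrightarrow> m \<sqsubseteq> q\<close>[OF _ adj_sym] by blast
  qed
  have "m \<in> above r m" using refl mV by (simp add: above_def)
  from ex_maximal[OF this] obtain s where s: "m \<sqsubseteq> s"
    and max: "\<And>z. m \<sqsubseteq> z \<Longrightarrow> s \<sqsubseteq> z \<Longrightarrow> z = s" by (auto simp: above_def)
  have "underS r s \<subseteq> above r m"
  proof
    fix p assume p: "p \<in> underS r s"
    show "p \<in> above r m"
    proof (rule ccontr)
      assume "p \<notin> above r m"
      with crossing[of p "- above r m" s] p s obtain p1 q1 where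
        "\<not> m \<sqsubseteq> p1" "m \<sqsubseteq> q1" "covers r q1 p1" by (auto simp: underS_def above_def)
      with closed show False by blast
    qed
  qed
  with chain have "underS r s \<in> Chains r" by (rule Chains_subset_mono)
  moreover have "aboveS r s = {}" using max s trans unfolding aboveS_def by blast
  ultimately have "chain_bottom V (r\<inverse>) s" using le_V[OF s] by (simp add: chain_bottom_def)
  then have "t \<noteq> m \<and> t \<noteq> s" "chain_bottom V (r\<inverse>) t \<Longrightarrow> t = s" "chain_bottom V r t \<Longrightarrow> t = m"
    using no_very_good.chain_bottom_unique[OF dual_no_very_good] chain_bottom_unique m mt s refl mV by blast+
  with t(1) show False by (auto simp: chain_end_def)
qed

text \<open>From inside the branch, \<open>m\<close> could get up to \<open>x\<close> only via
  \<open>c\<close>. If the branch were straight, its bottom would be a second chain bottom; so it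
  contains a chain end, and this is not \<open>m\<close>.\<close>

lemma leaving_branch:
  assumes "chain_bottom V r m" "m \<sqsubseteq> x" "covers r x c" "\<not> m \<sqsubseteq> c"
  shows "m \<notin> branch r x c" "\<exists>t\<in>branch r x c. chain_bottom V (r\<inverse>) t"
proof -
  have x: "x \<notin> branch r x c" using not_in_branch covers_neq[OF assms(3)] by blast
  show m: "m \<notin> branch r x c" using branch_up_exit[OF assms(3) _ x assms(2)] assms(4) by blast
  have "above r m \<in> Chains r" using assms(1) above_Chains by (simp add: chain_bottom_def)
  then have chain: "above r x \<in> Chains r"
    by (rule Chains_subset_mono) (use trans[OF assms(2)] in \<open>auto simp: above_def\<close>)
  have "\<not> straight r x c"
  proof
    assume "straight r x c"
    from straight_bottom[OF assms(3) this] chain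
    obtain e where "e \<in> branch r x c" "chain_bottom V r e" by auto
    with m chain_bottom_unique[OF assms(1)] show False by blast
  qed
  then obtain t where "t \<in> branch r x c" "chain_end V r t" using branch_straight[OF assms(3)] by blast
  with m chain_bottom_unique[OF assms(1)] show "\<exists>t\<in>branch r x c. chain_bottom V (r\<inverse>) t" by (auto simp: chain_end_def)
qed

end

section \<open>The path from \<open>m\<close> up to \<open>x\<close>, down to \<open>c\<close> and
  on to \<open>t\<close>\<close>

locale bend = no_very_good +
  fixes m x c t :: 'a
  assumes m: "chain_bottom V r m" and mx: "m \<sqsubseteq> x" and xc: "covers r x c" and mc: "\<not> m \<sqsubseteq> c"
    and t: "t \<in> branch r x c" "chain_bottom V (r\<inverse>) t"
begin

lemma m_V: "m \<in> V" and m_min: "underS r m = {}" and m_chain: "above r m \<in> Chains r"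
  using m above_Chains by (auto simp: chain_bottom_def)

lemma c_le_x: "c \<sqsubseteq> x"
  using covers_le[OF xc] .

lemma m_neq_x: "m \<noteq> x"
  using m_min xc c_le_x covers_neq by (auto simp: underS_def)

text \<open>Both leaving branches contain the unique \<open>t\<close>. Neither contains the upper
  end of the other edge, since being closed downwards it would contain \<open>m\<close>. So
  different edges would give disjoint branches.\<close>

lemma leaving_edge_unique:
  assumes "m \<sqsubseteq> x'" "covers r x' c'" "\<not> m \<sqsubseteq> c'"
  shows "x' = x \<and> c' = c"
proof (rule ccontr)
  assume ne: "\<not> (x' = x \<and> c' = c)"
  obtain t' where t': "t' \<in> branch r x' c'" "chain_bottom V (r\<inverse>) t'"
    using leaving_branch(2)[OF m assms] by blast
  have "t' = t" using no_very_good.chain_bottom_unique[OF dual_no_very_good] t' t by blast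
  moreover have "x' \<notin> branch r x c"
    using branch_down_closed[OF xc _ assms(1)] leaving_branch(1)[OF m mx xc mc] by blast
  moreover have "x \<notin> branch r x' c'"
    using branch_down_closed[OF assms(2) _ mx] leaving_branch(1)[OF m assms] by blast
  ultimately show False
    using branch_disjoint[of x c x' c'] xc assms(2) ne t(1) t'(1) by (auto simp: adj_def)
qed

lemma cone_exit:
  assumes "p \<sqsubseteq> q" "\<not> m \<sqsubseteq> p" "m \<sqsubseteq> q"
  shows "p \<sqsubseteq> c \<and> x \<sqsubseteq> q"
proof -
  from crossing[of p "- above r m" q] assms obtain p1 q1 where
    "\<not> m \<sqsubseteq> p1" "m \<sqsubseteq> q1" "p \<sqsubseteq> p1" "covers r q1 p1" "q1 \<sqsubseteq> q" by (auto simp: above_def)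
  with leaving_edge_unique show ?thesis by blast
qed

lemma not_m_le: "p \<sqsubseteq> c \<Longrightarrow> \<not> m \<sqsubseteq> p"
  using trans mc by blast

text \<open>\<open>m\<close> and \<open>t\<close> are the only chain ends.\<close>

lemma straight_lower:
  assumes "covers r w y" "m \<notin> branch r w y" "t \<notin> branch r w y"
  shows "straight r w y"
proof (rule branch_straight[OF assms(1)])
  fix q assume "q \<in> branch r w y"
  with assms show "\<not> chain_end V r q"
    using chain_bottom_unique[OF m] no_very_good.chain_bottom_unique[OF dual_no_very_good t(2)]
    unfolding chain_end_def by blast
qed

lemma straight_upper:
  assumes "covers r y w" "m \<notin> branch r w y" "t \<notin> branch r w y"
  shows "straight (r\<inverse>) w y"
proof -
  have "covers (r\<inverse>) w y" using assms(1) by simp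
  from no_very_good.branch_straight[OF dual_no_very_good this] show ?thesis
    using assms(2,3) chain_bottom_unique[OF m] no_very_good.chain_bottom_unique[OF dual_no_very_good t(2)]
    unfolding chain_end_converse branch_converse chain_end_def by blast
qed

text \<open>An ascent from \<open>m\<close> in this branch to \<open>x\<close> outside it would have
  to pass \<open>c\<close>, which is not above \<open>m\<close>.\<close>

lemma not_in_branch_c:
  assumes "adj r c u" "u \<noteq> x"
  shows "m \<notin> branch r c u"
proof
  assume mu: "m \<in> branch r c u"
  have x: "x \<notin> branch r c u"
    using branch_neighbour[OF assms(1)] xc assms(2) by (auto simp: adj_def)
  show False
  proof (cases "covers r u c")
    case True
    with branch_up_closed[OF True mu mx] x show False by blast
  next
    case False
    then have "covers r c u" using assms(1) by (auto simp: adj_def)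
    from branch_up_exit[OF this mu x mx] show False
      using not_m_le covers_le[OF \<open>covers r c u\<close>] by blast
  qed
qed

lemma t_cases: "\<exists>y. adj r c y \<and> y \<noteq> x \<and> t \<in> branch r c y"
proof -
  have "t \<noteq> c"
    using t(2) c_le_x mx mc by (auto simp: chain_bottom_def aboveS_def)
  then show ?thesis using branch_children[OF _ t(1)] xc by (auto simp: adj_def)
qed

text \<open>The top of the chain above \<open>m\<close>, to be paired with the top of a straight
  upper branch.\<close>

lemma ex_top:
  "\<exists>s. m \<sqsubseteq> s \<and> x \<sqsubseteq> s \<and> aboveS r s = {} \<and> (\<forall>p. p \<sqsubseteq> s \<longrightarrow> m \<sqsubseteq> p \<or> p \<sqsubseteq> c)"
proof -
  have "x \<in> above r m" using mx by (simp add: above_def)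
  from ex_maximal[OF this] obtain s where s: "m \<sqsubseteq> s"
    and max: "\<And>z. m \<sqsubseteq> z \<Longrightarrow> s \<sqsubseteq> z \<Longrightarrow> z = s" by (auto simp: above_def)
  have "x \<sqsubseteq> s" using m_chain max[OF mx] s mx by (auto simp: Chains_def above_def)
  moreover have "aboveS r s = {}" using max trans[OF s] by (auto simp: aboveS_def)
  ultimately show ?thesis using s cone_exit by blast
qed

lemma straight_top:
  assumes "covers r u z" "straight (r\<inverse>) z u"
  shows "\<exists>s. s \<in> branch r z u \<and> s \<in> V \<and> aboveS r s = {} \<and> u \<sqsubseteq> s \<and>
    (\<forall>q. q \<sqsubseteq> s \<longrightarrow> q \<in> branch r z u \<or> q \<sqsubseteq> z) \<and>
    (under r z \<in> Chains r \<longrightarrow> chain_bottom V (r\<inverse>) s)"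
  using forest_order.straight_bottom[OF dual, of z u] assms by (auto simp: straight_def)

text \<open>The top \<open>s'\<close> of such a branch and the top \<open>s\<close> of the chain
  above \<open>m\<close> would be very good in the dual: everything below \<open>c\<close> is below
  both, and the rest of each down-set lies in a chain.\<close>

lemma no_straight_upper:
  assumes u: "covers r u c" "u \<noteq> x"
  shows "\<not> straight (r\<inverse>) c u"
proof
  assume str: "straight (r\<inverse>) c u"
  obtain s where s: "m \<sqsubseteq> s" "x \<sqsubseteq> s" "aboveS r s = {}" "\<And>p. p \<sqsubseteq> s \<Longrightarrow> m \<sqsubseteq> p \<or> p \<sqsubseteq> c"
    using ex_top by blast
  obtain s' where s': "s' \<in> branch r c u" "s' \<in> V" "aboveS r s' = {}" "u \<sqsubseteq> s'"
    and s'_down: "\<And>q. q \<sqsubseteq> s' \<Longrightarrow> q \<in> branch r c u \<or> q \<sqsubseteq> c"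
    using straight_top[OF u(1) str] by blast
  have cs: "p \<sqsubseteq> s" if "p \<sqsubseteq> c" for p using trans[OF that trans[OF c_le_x s(2)]] .
  have cs': "p \<sqsubseteq> s'" if "p \<sqsubseteq> c" for p
    using trans[OF that trans[OF covers_le[OF u(1)] s'(4)]] .
  have ne: "s \<noteq> s'"
  proof
    assume "s = s'"
    then have "u \<sqsubseteq> s" using s' by simp
    with unique_cover_below[OF u(1) xc _ s(2)] u(2) show False by blast
  qed
  have 1: "underS r s - underS r s' \<subseteq> above r m"
  proof
    fix p assume "p \<in> underS r s - underS r s'"
    \<comment> \<open>\<open>underS\<close> is strict, so \<open>s'\<close> itself is not excluded
      from the difference; hence the first disjunct.\<close>
    then have p: "p \<sqsubseteq> s" "p = s' \<or> \<not> p \<sqsubseteq> s'" by (auto simp: underS_def)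
    have "\<not> p \<sqsubseteq> c"
    proof
      assume "p \<sqsubseteq> c"
      then have "p = s'" using p cs' by blast
      then show False using \<open>p \<sqsubseteq> c\<close> s'(4) covers_not_le[OF u(1)] trans by blast
    qed
    with s(4)[OF p(1)] show "p \<in> above r m" by (simp add: above_def)
  qed
  have 2: "underS r s' - underS r s \<subseteq> branch r c u"
  proof
    fix p assume "p \<in> underS r s' - underS r s"
    then have p: "p \<sqsubseteq> s'" "p = s \<or> \<not> p \<sqsubseteq> s" by (auto simp: underS_def)
    have "\<not> p \<sqsubseteq> c"
    proof
      assume "p \<sqsubseteq> c"
      then have "p = s" using p cs by blast
      then show False using \<open>p \<sqsubseteq> c\<close> not_m_le s(1) by blast
    qed
    with s'_down[OF p(1)] show "p \<in> branch r c u" by blast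
  qed
  have "very_good_pair V r s s'"
  proof (rule very_good_pair_dualI)
    show "s \<in> V" using s(1) le_V by blast
    show "underS r s - underS r s' \<in> Chains r" using Chains_subset_mono[OF m_chain 1] .
    have "branch r c u \<in> Chains r" using str by (simp add: straight_def)
    from Chains_subset_mono[OF this 2] show "underS r s' - underS r s \<in> Chains r" .
  qed (use s s' ne in auto)
  then show False using no_very_good by blast
qed

text \<open>
  If the path to \<open>t\<close> continues downwards from \<open>c\<close>, then \<open>x\<close> is the only upper cover of \<open>c\<close>, and the
  lower cover of \<open>x\<close> above \<open>m\<close> forms a very good pair with \<open>c\<close> unless \<open>D(c)\<close> branches, at \<open>w\<close> say. The
  branch below \<open>w\<close> avoiding \<open>t\<close> is straight, so its bottom would compete with \<open>m\<close> unless some \<open>z\<close>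
  between \<open>w\<close> and \<open>c\<close> has a second upper cover.
\<close>

lemma t_not_below:
  assumes y: "covers r c y" "t \<in> branch r c y"
  shows False
proof -
  have yx: "y \<noteq> x" using y(1) covers_not_le[OF xc] covers_le by blast
  have only_x: "u = x" if u: "covers r u c" for u
  proof (rule ccontr)
    assume "u \<noteq> x"
    have "u \<noteq> y" using u y(1) covers_not_le covers_le by blast
    then have "branch r c u \<inter> branch r c y = {}"
      using branch_siblings_disjoint[of c u y] u y(1) by (auto simp: adj_def)
    then have "straight (r\<inverse>) c u"
      using straight_upper[OF u] not_in_branch_c[OF _ \<open>u \<noteq> x\<close>] u y(2) by (auto simp: adj_def)
    with no_straight_upper[OF u \<open>u \<noteq> x\<close>] show False by blast
  qed
  have U_c: "aboveS r c = above r x" using aboveS_cover[OF xc only_x] .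
  have x_chain: "above r x \<in> Chains r"
    using m_chain by (rule Chains_subset_mono) (use trans[OF mx] in \<open>auto simp: above_def\<close>)
  obtain v where v: "covers r x v" "m \<sqsubseteq> v" using ex_cover_down[OF mx m_neq_x] by blast
  have U_v: "aboveS r v = above r x"
  proof (rule aboveS_cover[OF v(1)])
    fix q assume q: "covers r q v"
    then have "m \<sqsubseteq> q" using trans[OF v(2) covers_le] by blast
    then have "q \<sqsubseteq> x \<or> x \<sqsubseteq> q" using m_chain mx by (auto simp: Chains_def above_def)
    then show "q = x"
      using covers_between[OF v(1) covers_le[OF q]] covers_between[OF q covers_le[OF v(1)]]
        covers_neq[OF q] covers_neq[OF v(1)] by blast
  qed
  have "underS r v \<subseteq> above r m"
    using cone_exit[OF _ _ v(2)] covers_not_le[OF v(1)] by (auto simp: underS_def above_def)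
  then have D_v: "underS r v \<in> Chains r" using m_chain Chains_subset_mono by blast
  have "underS r c \<notin> Chains r"
    using no_very_good_lower_siblings[OF v(1) xc U_v U_c D_v] v(2) mc by blast
  then have "under r c \<notin> Chains r"
    using Chains_subset_mono[of "under r c" r "underS r c"] by (auto simp: under_def underS_def)
  from ex_branching_below[OF le_V(1)[OF c_le_x] this] obtain w0 where
    "w0 \<in> {w. w \<sqsubseteq> c \<and> (\<exists>y1 y2. covers r w y1 \<and> covers r w y2 \<and> y1 \<noteq> y2)}" by blast
  \<comment> \<open>The highest such \<open>w\<close> is taken, so that elements above
    \<open>w\<close> and up to \<open>c\<close> have at most one lower cover. This later determines
    the down-set of \<open>z'\<close>.\<close>
  from ex_maximal[OF this] obtain w a1 a2 where w: "w \<sqsubseteq> c"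
    and a: "covers r w a1" "covers r w a2" "a1 \<noteq> a2"
    and wmax: "\<And>z y1 y2. z \<sqsubseteq> c \<Longrightarrow> w \<sqsubseteq> z \<Longrightarrow> covers r z y1 \<Longrightarrow> covers r z y2 \<Longrightarrow> y1 \<noteq> y2 \<Longrightarrow> z = w"
    by blast
  have m_w: "m \<notin> branch r w b" if b: "covers r w b" for b
  proof
    assume mb: "m \<in> branch r w b"
    have wb: "w \<notin> branch r w b" using not_in_branch covers_neq[OF b] by blast
    show False
    proof (cases "x \<in> branch r w b")
      case True
      then show False
        using branch_down_closed[OF b branch_down_closed[OF b True c_le_x] w] wb by blast
    next
      case False
      from branch_up_exit[OF b mb False mx] show False
        using not_m_le[OF w] trans covers_le[OF b] by blast
    qed
  qed
  \<comment> \<open>Lower branches at \<open>w\<close> without \<open>t\<close> are straight, and at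
    most one of them is straight.\<close>
  have "\<exists>y1 y2. covers r w y1 \<and> covers r w y2 \<and> y1 \<noteq> y2 \<and> t \<in> branch r w y1"
    using a straight_unique[OF a(1,2)] straight_lower[OF _ m_w] by metis
  then obtain y1 y2 where y12: "covers r w y1" "covers r w y2" "y1 \<noteq> y2" and ty1: "t \<in> branch r w y1"
    by blast
  have "branch r w y1 \<inter> branch r w y2 = {}"
    using branch_siblings_disjoint y12 by (auto simp: adj_def)
  then have str2: "straight r w y2" using straight_lower[OF y12(2) m_w[OF y12(2)]] ty1 by blast
  \<comment> \<open>Otherwise the bottom of the branch at \<open>y2\<close> would be a second chain
    bottom.\<close>
  have "above r w \<notin> Chains r"
    using straight_bottom[OF y12(2) str2] chain_bottom_unique[OF m] m_w[OF y12(2)] by blast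
  then have "w \<in> {z. w \<sqsubseteq> z \<and> z \<sqsubseteq> c \<and> above r z \<notin> Chains r}" using w refl le_V by blast
  \<comment> \<open>With \<open>z\<close> chosen highest, its cover \<open>z'\<close> towards
    \<open>c\<close> has a chain above it, so \<open>z\<close> needs a second upper cover
    \<open>u\<close>.\<close>
  from ex_maximal[OF this] obtain z where z: "w \<sqsubseteq> z" "z \<sqsubseteq> c" "above r z \<notin> Chains r"
    and zmax: "\<And>z'. w \<sqsubseteq> z' \<Longrightarrow> z' \<sqsubseteq> c \<Longrightarrow> above r z' \<notin> Chains r \<Longrightarrow> z \<sqsubseteq> z' \<Longrightarrow> z' = z"
    by blast
  have "above r c \<in> Chains r" using above_Chains U_c x_chain by simp
  then have "z \<noteq> c" using z by blast
  then obtain z' where z': "covers r z' z" "z' \<sqsubseteq> c" using ex_cover_up[OF z(2)] by blast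
  have wz': "w \<sqsubseteq> z'" "z' \<noteq> w"
    using trans[OF z(1) covers_le[OF z'(1)]] z(1) covers_not_le[OF z'(1)] by auto
  have z'_chain: "above r z' \<in> Chains r"
    using zmax[OF wz'(1) z'(2)] covers_le[OF z'(1)] covers_neq[OF z'(1)] by blast
  have "aboveS (r\<inverse>) z' = above (r\<inverse>) z"
  proof (rule forest_order.aboveS_cover[OF dual])
    show "covers (r\<inverse>) z z'" using z'(1) by simp
    fix q assume "covers (r\<inverse>) q z'"
    then have "covers r z' q" by simp
    with wmax[OF z'(2) wz'(1) z'(1)] wz'(2) show "q = z" by blast
  qed
  then have D_z': "underS r z' = under r z" by simp
  have "aboveS r z \<notin> Chains r" using z(3) above_Chains by blast
  then have "\<exists>u. covers r u z \<and> u \<noteq> z'"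
    using aboveS_cover[OF z'(1)] z'_chain by metis
  then obtain u where u: "covers r u z" "u \<noteq> z'" by blast
  have m_u: "m \<notin> branch r z u" and w_u: "w \<notin> branch r z u"
  proof -
    have zu: "z \<notin> branch r z u" using not_in_branch covers_neq[OF u(1)] by metis
    show "w \<notin> branch r z u" using branch_up_closed[OF u(1) _ z(1)] zu by blast
    have c: "c \<notin> branch r z u"
    proof
      assume "c \<in> branch r z u"
      from branch_down_exit[OF u(1) this zu z(2)] have "u \<sqsubseteq> c" by simp
      from unique_cover_below[OF u(1) z'(1) this z'(2)] u(2) show False by blast
    qed
    show "m \<notin> branch r z u"
    proof
      assume "m \<in> branch r z u"
      from branch_up_closed[OF u(1) this mx] have "x \<in> branch r z u" .
      from branch_down_exit[OF u(1) this c c_le_x] show False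
        using antisym[OF z(2)] \<open>z \<noteq> c\<close> by blast
    qed
  qed
  have "z \<notin> branch r w y1"
    using branch_down_closed[OF y12(1) _ z(1)] not_in_branch covers_neq[OF y12(1)] by blast
  then have "branch r w y1 \<inter> branch r z u = {}"
    using branch_disjoint[of w y1 z u] y12(1) u(1) w_u covers_le[OF y12(1)] covers_not_le[OF u(1)]
    by (auto simp: adj_def)
  then have str_u: "straight (r\<inverse>) z u" using straight_upper[OF u(1) m_u] ty1 by blast
  \<comment> \<open>\<open>u\<close> and \<open>z'\<close> have the same down-set, all elements up
    to \<open>z\<close>, and chains above them.\<close>
  have "u = z'"
  proof (rule no_very_good.no_very_good_lower_siblings[OF dual_no_very_good])
    show "covers (r\<inverse>) z u" "covers (r\<inverse>) z z'" using u(1) z'(1) by simp_all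
    show "aboveS (r\<inverse>) u = above (r\<inverse>) z"
      using forest_order.straight_aboveS[OF dual _ str_u] u(1) by simp
    show "aboveS (r\<inverse>) z' = above (r\<inverse>) z" using D_z' by simp
    show "underS (r\<inverse>) u \<in> Chains (r\<inverse>)"
      using forest_order.straight_underS[OF dual _ str_u] u(1) by simp
    show "underS (r\<inverse>) z' \<in> Chains (r\<inverse>)"
      using z'_chain Chains_subset_mono[of "above r z'" r "aboveS r z'"]
      by (auto simp: above_def aboveS_def)
  qed
  with u(2) show False by blast
qed

text \<open>
  If the path to \<open>t\<close> continues upwards via \<open>c'\<close>, the pair of \<open>m\<close> and the bottom \<open>d\<close> of \<open>c\<close> forces a first
  branching point \<open>z\<close> above \<open>c'\<close>, with a straight branch that has top \<open>s'\<close>. Uniqueness of \<open>t\<close> forces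
  side branches below the interval from \<open>c'\<close> to \<open>z\<close>. The lowest is attached at \<open>c'\<close>; two of them
  have bottoms \<open>e\<close> and \<open>e'\<close> forming a very good pair, and if there is only one, then \<open>s'\<close> and the top
  of the chain above \<open>m\<close> form one.
\<close>

lemma t_not_above:
  assumes c': "covers r c' c" "c' \<noteq> x" "t \<in> branch r c c'"
  shows False
proof -
  have cc': "c \<sqsubseteq> c'" using covers_le[OF c'(1)] .
  have c'V: "c' \<in> V" using le_V[OF cc'] by blast
  \<comment> \<open>\<open>c'\<close> and \<open>x\<close> are distinct covers of \<open>c\<close>,
    hence have no common upper bound.\<close>
  have not_both: False if "c' \<sqsubseteq> q" "x \<sqsubseteq> q" for q
    using unique_cover_below[OF c'(1) xc that] c'(2) by blast
  have t_other: "t \<notin> branch r c u" if "adj r c u" "u \<noteq> c'" for u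
    using branch_siblings_disjoint[of c u c'] that c' by (auto simp: adj_def)
  have lower: "straight r c y" if y: "covers r c y" for y
  proof -
    have "y \<noteq> x" "y \<noteq> c'"
      using covers_le[OF y] covers_not_le[OF xc] covers_not_le[OF c'(1)] by auto
    then show ?thesis
      using straight_lower[OF y] not_in_branch_c t_other y by (auto simp: adj_def)
  qed
  have c_chain: "under r c \<in> Chains r" using under_Chains_if_straight lower by blast
  have upper: "u = x \<or> u = c'" if u: "covers r u c" for u
    using no_straight_upper[OF u] straight_upper[OF u] not_in_branch_c[of u] t_other[of u] u
    by (auto simp: adj_def)
  have "c \<in> under r c" using refl le_V[OF cc'] by (simp add: under_def)
  from ex_minimal[OF this] obtain d where d: "d \<sqsubseteq> c"
    and dmin: "\<And>w. w \<sqsubseteq> c \<Longrightarrow> w \<sqsubseteq> d \<Longrightarrow> w = d" by (auto simp: under_def)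
  have d_min: "underS r d = {}" using dmin trans[OF _ d] by (auto simp: underS_def)
  have d_up: "q \<sqsubseteq> c \<or> c \<sqsubseteq> q" if q: "d \<sqsubseteq> q" for q
  proof (cases "d = c")
    case True
    with q show ?thesis by simp
  next
    case False
    then obtain y where y: "covers r c y" "d \<sqsubseteq> y" using ex_cover_down[OF d] by blast
    have dy: "d \<in> branch r c y" using branch_down_closed[OF y(1) branch_root y(2)] .
    show ?thesis
    proof (cases "q \<in> branch r c y")
      case True
      then have "q \<sqsubseteq> y" using lower[OF y(1)] by (simp add: straight_def)
      then show ?thesis using trans covers_le[OF y(1)] by blast
    next
      case False
      then show ?thesis using branch_up_exit[OF y(1) dy _ q] by blast
    qed
  qed
  \<comment> \<open>Otherwise \<open>m\<close> and \<open>d\<close> are very good: both are minimal,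
    and outside the cone of \<open>m\<close> the elements above \<open>d\<close> are below
    \<open>c\<close> or above \<open>c'\<close>.\<close>
  have "above r c' \<notin> Chains r"
  proof
    assume ch: "above r c' \<in> Chains r"
    have un: "under r c \<union> above r c' \<in> Chains r"
    proof (rule Chains_Un[OF c_chain ch])
      fix p q assume "p \<in> under r c" "q \<in> above r c'"
      then show "p \<sqsubseteq> q" using trans[OF trans[OF _ cc']] by (auto simp: under_def above_def)
    qed
    have sub: "aboveS r d - aboveS r m \<subseteq> under r c \<union> above r c'"
    proof
      fix p assume "p \<in> aboveS r d - aboveS r m"
      then have p: "d \<sqsubseteq> p" "p = m \<or> \<not> m \<sqsubseteq> p" by (auto simp: aboveS_def)
      show "p \<in> under r c \<union> above r c'"
      proof (cases "p \<sqsubseteq> c")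
        case True
        then show ?thesis by (simp add: under_def)
      next
        case False
        then have "c \<sqsubseteq> p" "c \<noteq> p" using d_up[OF p(1)] d by auto
        then obtain u where u: "covers r u c" "u \<sqsubseteq> p" using ex_cover_up by blast
        have "u \<noteq> x"
        proof
          assume "u = x"
          then have "x \<sqsubseteq> p" using u by simp
          then show False using p(2) trans[OF mx] antisym[OF mx] m_neq_x by blast
        qed
        then show ?thesis using upper[OF u(1)] u(2) by (auto simp: above_def)
      qed
    qed
    have "very_good_pair V r m d"
    proof (rule very_good_pairI)
      show "m \<in> V" by (rule m_V)
      show "d \<in> V" using le_V[OF d] by blast
      show "m \<noteq> d" using d mc by blast
      show "underS r m = underS r d" using m_min d_min by simp
      show "aboveS r d - aboveS r m \<in> Chains r" using Chains_subset_mono[OF un sub] .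
      show "aboveS r m - aboveS r d \<in> Chains r"
        using m_chain by (rule Chains_subset_mono) (auto simp: above_def aboveS_def)
    qed
    then show False using no_very_good by blast
  qed
  from ex_branching_above[OF c'V this] obtain z0 where
    "z0 \<in> {z. c' \<sqsubseteq> z \<and> (\<exists>u1 u2. covers r u1 z \<and> covers r u2 z \<and> u1 \<noteq> u2)}" by blast
  \<comment> \<open>As \<open>z\<close> is a lowest branching point, vertices from \<open>c'\<close>
    up to but excluding \<open>z\<close> have at most one upper cover.\<close>
  from ex_minimal[OF this] obtain z u1 u2 where c'z: "c' \<sqsubseteq> z"
    and u12: "covers r u1 z" "covers r u2 z" "u1 \<noteq> u2"
    and zmin: "\<And>w v1 v2. c' \<sqsubseteq> w \<Longrightarrow> w \<sqsubseteq> z \<Longrightarrow> covers r v1 w \<Longrightarrow> covers r v2 w \<Longrightarrow> v1 \<noteq> v2 \<Longrightarrow> w = z"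
    by blast
  have zV: "z \<in> V" using le_V[OF c'z] by blast
  have unique_up: "v1 = v2" if "c' \<sqsubseteq> w" "w \<sqsubseteq> z" "w \<noteq> z" "covers r v1 w" "covers r v2 w" for w v1 v2
    using zmin that by blast
  have m_zu: "m \<notin> branch r z u" if u: "covers r u z" for u
  proof
    assume mu: "m \<in> branch r z u"
    have zu: "z \<notin> branch r z u" using not_in_branch covers_neq[OF u] by metis
    have cu: "c \<notin> branch r z u" using branch_up_closed[OF u _ trans[OF cc' c'z]] zu by blast
    have "u \<sqsubseteq> x"
      using branch_down_exit[OF u branch_up_closed[OF u mu mx] cu c_le_x] by blast
    then have "c' \<sqsubseteq> x" using trans[OF trans[OF c'z covers_le[OF u]]] by blast
    then show False using not_both refl le_V[OF mx] by blast
  qed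
  \<comment> \<open>No upper branch at \<open>z\<close> contains \<open>m\<close>, so one without
    \<open>t\<close> is straight; at most one is. So some \<open>u'\<close> leads to
    \<open>t\<close>, and another cover \<open>u\<close> does not.\<close>
  have "\<exists>u u'. covers r u z \<and> covers r u' z \<and> u \<noteq> u' \<and> t \<in> branch r z u'"
  proof (rule ccontr)
    assume "\<not> ?thesis"
    then have "t \<notin> branch r z u1" "t \<notin> branch r z u2" using u12 by blast+
    then have "straight (r\<inverse>) z u1" "straight (r\<inverse>) z u2"
      using straight_upper u12 m_zu by blast+
    then show False
      using no_very_good.straight_unique[OF dual_no_very_good, of z u1 u2] u12 by simp
  qed
  then obtain u u' where u: "covers r u z" and u': "covers r u' z" "u \<noteq> u'" "t \<in> branch r z u'"
    by blast
  have t_u: "t \<notin> branch r z u"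
    using branch_siblings_disjoint[of z u u'] u u' by (auto simp: adj_def)
  have str_u: "straight (r\<inverse>) z u" using straight_upper[OF u m_zu[OF u] t_u] .
  obtain s' where s': "s' \<in> branch r z u" "s' \<in> V" "aboveS r s' = {}" "u \<sqsubseteq> s'"
    and s'_down: "\<And>q. q \<sqsubseteq> s' \<Longrightarrow> q \<in> branch r z u \<or> q \<sqsubseteq> z"
    and s'_bottom: "under r z \<in> Chains r \<Longrightarrow> chain_bottom V (r\<inverse>) s'"
    using straight_top[OF u str_u] by blast
  \<comment> \<open>Otherwise \<open>s'\<close> would compete with \<open>t\<close>.\<close>
  have z_nonchain: "under r z \<notin> Chains r"
    using s'_bottom no_very_good.chain_bottom_unique[OF dual_no_very_good t(2)] s'(1) t_u by blast
  \<comment> \<open>Edges descending from the interval between \<open>c'\<close> and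
    \<open>z\<close> out of the cone above \<open>c'\<close>, except the edge back to
    \<open>c\<close>.\<close>
  define side where "side h g \<longleftrightarrow> c' \<sqsubseteq> h \<and> h \<sqsubseteq> z \<and> covers r h g \<and> \<not> c' \<sqsubseteq> g \<and> g \<noteq> c" for h g
  have side_straight: "straight r h g" if hg: "side h g" for h g
  proof -
    from hg have h: "c' \<sqsubseteq> h" "h \<sqsubseteq> z" and g: "covers r h g" "\<not> c' \<sqsubseteq> g" "g \<noteq> c"
      by (auto simp: side_def)
    have h_notin: "h \<notin> branch r h g" using not_in_branch covers_neq[OF g(1)] by blast
    have "m \<notin> branch r h g"
    proof
      assume mg: "m \<in> branch r h g"
      show False
      proof (cases "x \<in> branch r h g")
        case True
        have "c \<sqsubseteq> g"
          using branch_up_exit[OF g(1) branch_down_closed[OF g(1) True c_le_x] h_notin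
              trans[OF cc' h(1)]] by blast
        then obtain v where v: "covers r v c" "v \<sqsubseteq> g" using ex_cover_up g(3) by blast
        with upper[OF v(1)] g(2) have "x \<sqsubseteq> g" by auto
        then show False using not_both[OF h(1)] trans covers_le[OF g(1)] by blast
      next
        case False
        from branch_up_exit[OF g(1) mg False mx] have "h \<sqsubseteq> x" by blast
        then show False using not_both[OF trans[OF h(1)]] refl le_V[OF mx] by blast
      qed
    qed
    moreover have "t \<notin> branch r h g"
    proof -
      have 1: "z \<notin> branch r h g" using branch_down_closed[OF g(1) _ h(2)] h_notin by blast
      have "z \<notin> branch r z u'" using not_in_branch covers_neq[OF u'(1)] by metis
      then have 2: "h \<notin> branch r z u'" using branch_up_closed[OF u'(1) _ h(2)] by blast
      have 3: "h \<noteq> z \<or> g \<noteq> u'" using covers_le[OF g(1)] covers_not_le[OF u'(1)] by blast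
      have "branch r h g \<inter> branch r z u' = {}"
        using branch_disjoint[OF _ _ 1 2 3] g(1) u'(1) by (auto simp: adj_def)
      with u'(3) show ?thesis by blast
    qed
    ultimately show ?thesis using straight_lower[OF g(1)] by blast
  qed
  define mid where "mid = {q. c' \<sqsubseteq> q \<and> q \<sqsubseteq> z}"
  have mid_chain: "mid \<in> Chains r" using interval_chain by (intro ChainsI) (auto simp: mid_def)
  have below: "q \<in> mid \<or> q \<sqsubseteq> c \<or> (\<exists>h' g. side h' g \<and> h' \<sqsubseteq> h \<and> q \<sqsubseteq> g)"
    if h: "q \<sqsubseteq> h" "c' \<sqsubseteq> h" "h \<sqsubseteq> z" for q h
  proof (cases "c' \<sqsubseteq> q")
    case True
    then show ?thesis using trans[OF h(1,3)] by (simp add: mid_def)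
  next
    case False
    with crossing[of q "- above r c'" h] h obtain g h' where
      g: "\<not> c' \<sqsubseteq> g" "c' \<sqsubseteq> h'" "q \<sqsubseteq> g" "covers r h' g" "h' \<sqsubseteq> h" by (auto simp: above_def)
    then have "g = c \<or> side h' g" using trans[OF g(5) h(3)] by (auto simp: side_def)
    with g show ?thesis by blast
  qed
  have lower_mid: "under r c \<union> mid \<in> Chains r"
  proof (rule Chains_Un[OF c_chain mid_chain])
    fix p q assume "p \<in> under r c" "q \<in> mid"
    then show "p \<sqsubseteq> q" using trans[OF trans[OF _ cc']] by (auto simp: under_def mid_def)
  qed
  \<comment> \<open>Without side edges, everything below \<open>z\<close> would lie in the chain
    \<open>lower_mid\<close>.\<close>
  have "\<exists>h g. side h g"
  proof (rule ccontr)
    assume "\<nexists>h g. side h g"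
    then have "under r z \<subseteq> under r c \<union> mid"
      using below[OF _ c'z refl[OF zV]] by (auto simp: under_def)
    with lower_mid z_nonchain show False using Chains_subset_mono by blast
  qed
  then obtain h0 where "h0 \<in> {h. \<exists>g. side h g}" by blast
  from ex_minimal[OF this] obtain h g where hg: "side h g"
    and hmin: "\<And>h' g'. side h' g' \<Longrightarrow> h' \<sqsubseteq> h \<Longrightarrow> h' = h" by blast
  from hg have h: "c' \<sqsubseteq> h" "h \<sqsubseteq> z" and g: "covers r h g" "\<not> c' \<sqsubseteq> g"
    by (auto simp: side_def)
  \<comment> \<open>Otherwise the interval contains a lower cover \<open>k\<close> of
    \<open>h\<close>. No side edge starts at or below \<open>k\<close>, so its down-set is a chain,
    and \<open>k\<close> and \<open>g\<close> have equal up-sets.\<close>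
  have "h = c'"
  proof (rule ccontr)
    assume "h \<noteq> c'"
    then obtain k where k: "covers r h k" "c' \<sqsubseteq> k" using ex_cover_down[OF h(1)] by blast
    have kz: "k \<sqsubseteq> z" using trans[OF covers_le[OF k(1)] h(2)] .
    have "k \<noteq> z" using covers_not_le[OF k(1)] h(2) by blast
    have U_k: "aboveS r k = above r h"
      by (rule aboveS_cover[OF k(1)]) (use unique_up[OF k(2) kz \<open>k \<noteq> z\<close>] k(1) in blast)
    have "underS r k \<subseteq> under r c \<union> mid"
    proof
      fix q assume "q \<in> underS r k"
      then have "q \<sqsubseteq> k" by (simp add: underS_def)
      moreover have False if "side h' g'" "h' \<sqsubseteq> k" for h' g'
        using hmin[OF that(1) trans[OF that(2) covers_le[OF k(1)]]] that(2)
          covers_not_le[OF k(1)] by blast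
      ultimately show "q \<in> under r c \<union> mid"
        using below[OF _ k(2) kz] unfolding under_def by blast
    qed
    with lower_mid have D_k: "underS r k \<in> Chains r" by (rule Chains_subset_mono)
    have str: "straight r h g" using side_straight[OF hg] .
    have "k = g"
      using no_very_good_lower_siblings[OF k(1) g(1) U_k straight_aboveS[OF g(1) str] D_k
          straight_underS[OF g(1) str]] .
    with k(2) g(2) show False by blast
  qed
  with hg g have side_c': "side c' g" and gc': "covers r c' g" by auto
  have str_g: "straight r c' g" using side_straight[OF side_c'] .
  have g_chain: "branch r c' g \<in> Chains r" and g_top: "\<And>p. p \<in> branch r c' g \<Longrightarrow> p \<sqsubseteq> g"
    using str_g by (auto simp: straight_def)
  have g_mid: "branch r c' g \<union> mid \<in> Chains r"
  proof (rule Chains_Un[OF g_chain mid_chain])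
    fix p q assume "p \<in> branch r c' g" "q \<in> mid"
    then show "p \<sqsubseteq> q"
      using trans[OF trans[OF g_top covers_le[OF gc']]] by (auto simp: mid_def)
  qed
  show False
  \<comment> \<open>By \<open>straight_unique\<close> only one side edge starts at
    \<open>c'\<close>, so a second one must start elsewhere.\<close>
  proof (cases "\<exists>h' g'. side h' g' \<and> h' \<noteq> c'")
    case True
    then obtain h' g' where side': "side h' g'" and h'c': "h' \<noteq> c'" by blast
    then have h': "c' \<sqsubseteq> h'" "h' \<sqsubseteq> z" and g': "covers r h' g'" "\<not> c' \<sqsubseteq> g'"
      by (auto simp: side_def)
    have str_g': "straight r h' g'" using side_straight[OF side'] .
    obtain e where e: "e \<in> branch r c' g" "e \<in> V" "underS r e = {}"
      and e_up: "\<And>q. e \<sqsubseteq> q \<Longrightarrow> q \<in> branch r c' g \<or> c' \<sqsubseteq> q"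
      using straight_bottom[OF gc' str_g] by blast
    obtain e' where e': "e' \<in> branch r h' g'" "e' \<in> V" "underS r e' = {}"
      and e'_up: "\<And>q. e' \<sqsubseteq> q \<Longrightarrow> q \<in> branch r h' g' \<or> h' \<sqsubseteq> q"
      using straight_bottom[OF g'(1) str_g'] by blast
    have c'_notin: "c' \<notin> branch r c' g" using not_in_branch covers_neq[OF gc'] by blast
    have h'_notin: "h' \<notin> branch r h' g'" using not_in_branch covers_neq[OF g'(1)] by blast
    have 1: "h' \<notin> branch r c' g" using branch_down_closed[OF gc' _ h'(1)] c'_notin by blast
    have 2: "c' \<notin> branch r h' g'" using branch_up_exit[OF g'(1) _ h'_notin h'(1)] g'(2) by blast
    have "branch r c' g \<inter> branch r h' g' = {}"
      using branch_disjoint[OF _ _ 1 2] gc' g'(1) h'c' by (auto simp: adj_def)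
    with e e' have ne: "e \<noteq> e'" by blast
    have eg: "e \<sqsubseteq> g" using g_top e(1) .
    have eh': "e \<sqsubseteq> h'" using trans[OF trans[OF eg covers_le[OF gc']] h'(1)] .
    have e'g': "e' \<sqsubseteq> g'" using str_g' e'(1) by (simp add: straight_def)
    have e'h': "e' \<sqsubseteq> h'" using trans[OF e'g' covers_le[OF g'(1)]] .
    have sub': "aboveS r e' - aboveS r e \<subseteq> branch r h' g'"
    proof
      fix p assume "p \<in> aboveS r e' - aboveS r e"
      then have p: "e' \<sqsubseteq> p" "p = e \<or> \<not> e \<sqsubseteq> p" by (auto simp: aboveS_def)
      have "\<not> h' \<sqsubseteq> p"
      proof
        assume h'p: "h' \<sqsubseteq> p"
        then have "p = e" using p(2) trans[OF eh'] by blast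
        then have "c' \<sqsubseteq> g" using trans[OF trans[OF h'(1) h'p]] eg by blast
        with g(2) show False by blast
      qed
      with e'_up[OF p(1)] show "p \<in> branch r h' g'" by blast
    qed
    have sub: "aboveS r e - aboveS r e' \<subseteq> branch r c' g \<union> mid"
    proof
      fix p assume "p \<in> aboveS r e - aboveS r e'"
      then have p: "e \<sqsubseteq> p" "p = e' \<or> \<not> e' \<sqsubseteq> p" by (auto simp: aboveS_def)
      have not_h': "\<not> h' \<sqsubseteq> p"
      proof
        assume h'p: "h' \<sqsubseteq> p"
        then have "p = e'" using p(2) trans[OF e'h'] by blast
        then have "h' \<sqsubseteq> g'" using trans[OF h'p] e'g' by blast
        with covers_not_le[OF g'(1)] show False by blast
      qed
      show "p \<in> branch r c' g \<union> mid"
      proof (cases "p \<in> branch r c' g")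
        case False
        then have c'p: "c' \<sqsubseteq> p" using e_up[OF p(1)] by blast
        \<comment> \<open>There is no branching upwards between \<open>c'\<close> and
          \<open>h'\<close> below \<open>z\<close>.\<close>
        have "p \<sqsubseteq> h' \<or> h' \<sqsubseteq> p"
        proof (rule comparable_if_unique_covers[OF c'p h'(1)])
          fix w v1 v2 assume w: "c' \<sqsubseteq> w" "w \<sqsubseteq> h'" "w \<noteq> h'" "covers r v1 w" "covers r v2 w"
          have "w \<noteq> z" using antisym[OF w(2)] w(3) h'(2) by blast
          then show "v1 = v2" using unique_up[OF w(1) trans[OF w(2) h'(2)] _ w(4,5)] by blast
        qed
        with not_h' have "p \<sqsubseteq> z" using trans[OF _ h'(2)] by blast
        with c'p show ?thesis by (simp add: mid_def)
      qed simp
    qed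
    have "very_good_pair V r e e'"
    proof (rule very_good_pairI)
      show "aboveS r e - aboveS r e' \<in> Chains r" using Chains_subset_mono[OF g_mid sub] .
      have "branch r h' g' \<in> Chains r" using str_g' by (simp add: straight_def)
      from Chains_subset_mono[OF this sub'] show "aboveS r e' - aboveS r e \<in> Chains r" .
    qed (use e e' ne in auto)
    then show False using no_very_good by blast
  next
    case False
    have only_g: "h' = c' \<and> g' = g" if side': "side h' g'" for h' g'
    proof -
      have h'c': "h' = c'" using False side' by blast
      then have "covers r c' g'" "straight r c' g'"
        using side' side_straight[OF side'] by (auto simp: side_def)
      with straight_unique[OF gc' _ str_g] h'c' show ?thesis by blast
    qed
    obtain s where s: "m \<sqsubseteq> s" "x \<sqsubseteq> s" "aboveS r s = {}" "\<And>p. p \<sqsubseteq> s \<Longrightarrow> m \<sqsubseteq> p \<or> p \<sqsubseteq> c"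
      using ex_top by blast
    have c's': "c' \<sqsubseteq> s'" using trans[OF trans[OF c'z covers_le[OF u]] s'(4)] .
    have ne: "s \<noteq> s'" using not_both[OF c's'] s(2) by blast
    have sub: "underS r s - underS r s' \<subseteq> above r m"
    proof
      fix p assume "p \<in> underS r s - underS r s'"
      then have p: "p \<sqsubseteq> s" "p = s' \<or> \<not> p \<sqsubseteq> s'" by (auto simp: underS_def)
      have "\<not> p \<sqsubseteq> c"
      proof
        assume pc: "p \<sqsubseteq> c"
        then have "p = s'" using p(2) trans[OF trans[OF pc cc'] c's'] by blast
        then have "c' \<sqsubseteq> c" using trans[OF c's'] pc by blast
        with covers_not_le[OF c'(1)] show False by blast
      qed
      with s(4)[OF p(1)] show "p \<in> above r m" by (simp add: above_def)
    qed
    \<comment> \<open>Elements below \<open>c\<close> cancel, as \<open>c\<close> is below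
      \<open>s\<close>. What remains is the branch of \<open>g\<close>, the interval and the branch
      of \<open>u\<close>, stacked in this order.\<close>
    have sub': "underS r s' - underS r s \<subseteq> (branch r c' g \<union> mid) \<union> branch r z u"
    proof
      fix p assume "p \<in> underS r s' - underS r s"
      then have p: "p \<sqsubseteq> s'" "p = s \<or> \<not> p \<sqsubseteq> s" by (auto simp: underS_def)
      have not_c: "\<not> p \<sqsubseteq> c"
      proof
        assume pc: "p \<sqsubseteq> c"
        then have "p = s" using p(2) trans[OF trans[OF pc c_le_x] s(2)] by blast
        then show False using pc not_m_le s(1) by blast
      qed
      show "p \<in> (branch r c' g \<union> mid) \<union> branch r z u"
      proof (cases "p \<in> branch r z u")
        case False
        then have "p \<sqsubseteq> z" using s'_down[OF p(1)] by blast
        from below[OF this c'z refl[OF zV]] not_c have "p \<in> mid \<or> p \<sqsubseteq> g"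
          using only_g by blast
        then show ?thesis using branch_down_closed[OF gc' branch_root] by blast
      qed simp
    qed
    have "(branch r c' g \<union> mid) \<union> branch r z u \<in> Chains r"
    proof (rule Chains_Un[OF g_mid])
      show "branch r z u \<in> Chains r" using str_u by (simp add: straight_def)
      fix p q assume p: "p \<in> branch r c' g \<union> mid" and q: "q \<in> branch r z u"
      have "p \<sqsubseteq> z"
        using p trans[OF trans[OF g_top covers_le[OF gc']] c'z] by (auto simp: mid_def)
      moreover have "u \<sqsubseteq> q" using str_u q by (simp add: straight_def)
      ultimately show "p \<sqsubseteq> q" using trans[OF trans[OF _ covers_le[OF u]]] by blast
    qed
    from Chains_subset_mono[OF this sub'] Chains_subset_mono[OF m_chain sub]
    have "very_good_pair V r s s'"
      using s s' ne le_V[OF s(1)] by (intro very_good_pair_dualI) auto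
    then show False using no_very_good by blast
  qed
qed

end

lemma (in no_very_good) linear_if_chain_bottom:
  assumes "chain_bottom V r m"
  shows "linear_order_on V r"
proof (rule ccontr)
  assume "\<not> linear_order_on V r"
  then obtain x c where xc: "m \<sqsubseteq> x" "covers r x c" "\<not> m \<sqsubseteq> c"
    using chain_bottom_leaving_edge[OF assms] by blast
  then obtain t where "t \<in> branch r x c" "chain_bottom V (r\<inverse>) t"
    using leaving_branch(2)[OF assms] by blast
  with assms xc interpret bend V r m x c t by unfold_locales
  from t_cases t_not_below t_not_above show False unfolding adj_def by blast
qed

lemma (in no_very_good) linear:
  "linear_order_on V r"
proof (cases "V = {}")
  case True
  then show ?thesis using order by (simp add: linear_order_on_def)
next
  case False
  then obtain t where "chain_end V r t" using ex_chain_end_reachable by blast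
  then show ?thesis
    using linear_if_chain_bottom no_very_good.linear_if_chain_bottom[OF dual_no_very_good, of t]
    by (auto simp: chain_end_def)
qed

theorem ex_very_good_pair:
  assumes "finite V" "partial_order_on V r" "\<not> linear_order_on V r" "forest V (cover_edges V r)"
  shows "\<exists>a b. very_good_pair V r a b"
proof (rule ccontr)
  assume "\<nexists>a b. very_good_pair V r a b"
  with assms interpret no_very_good V r by unfold_locales auto
  from linear assms(3) show False by blast
qed

subsection \<open>From a very good pair to a balanced pair\<close>

text \<open>A maximal element is removed and put back on top of an extension of the rest. The result
  keeps the denominator of \<open>prob_before\<close> nonzero.\<close>

lemma ex_linear_extension:
  assumes "finite V" "partial_order_on V r"
  shows "linear_extensions V r \<noteq> {}"
  using assms
proof (induction "card V" arbitrary: V r)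
  case 0
  then have "V = {}" "r = {}" by (auto simp: order_on_defs)
  then show ?case by (auto simp: linear_extensions_def intro!: exI[of _ "{}"])
next
  case (Suc n)
  have "finite (r\<inverse>)" using Suc.prems by (auto simp: order_on_defs intro: finite_subset)
  then have "wf (r\<inverse> - Id)"
    using partial_order_on_well_order_on[of "r\<inverse>" V] Suc.prems by simp
  moreover have "r\<inverse> - Id = (r - Id)\<inverse>" by auto
  ultimately have "wf ((r - Id)\<inverse>)" by simp
  moreover obtain v where "v \<in> V" using Suc.hyps(2) by fastforce
  ultimately obtain x where x: "x \<in> V" "\<And>y. (y, x) \<in> (r - Id)\<inverse> \<Longrightarrow> y \<notin> V"
    by (metis wfE_min)
  have rV: "r \<subseteq> V \<times> V" and r: "refl_on V r" "trans r" "antisym r"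
    using Suc.prems(2) by (auto simp: order_on_defs)
  have xmax: "y = x" if "(x, y) \<in> r" for y using x(2)[of y] that rV by blast
  define s where "s = r \<inter> (V - {x}) \<times> (V - {x})"
  have "partial_order_on (V - {x}) s"
    using r unfolding order_on_defs s_def refl_on_def trans_def antisym_def by blast
  then have "linear_extensions (V - {x}) s \<noteq> {}"
    using Suc.hyps(1)[of "V - {x}" s] Suc.hyps(2) Suc.prems(1) x(1) by auto
  then obtain L where L: "linear_order_on (V - {x}) L" "s \<subseteq> L"
    by (auto simp: linear_extensions_def)
  let ?L = "L \<union> V \<times> {x}"
  have "linear_order_on V ?L"
    using L(1) x(1) unfolding order_on_defs refl_on_def trans_def antisym_def total_on_def by blast
  moreover have "r \<subseteq> ?L" using L(2) rV xmax unfolding s_def by blast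
  ultimately show ?case by (auto simp: linear_extensions_def)
qed

lemma finite_linear_extensions:
  assumes "finite V"
  shows "finite (linear_extensions V r)"
proof (rule finite_subset)
  show "linear_extensions V r \<subseteq> Pow (V \<times> V)"
    by (auto simp: linear_extensions_def order_on_defs)
qed (use assms in simp)

lemma Chains_enumeration:
  assumes "finite C" "C \<in> Chains r" "trans r" "antisym r"
  shows "\<exists>f. f ` {..<card C} = C \<and> (\<forall>j<card C. \<forall>i<j. (f i, f j) \<in> r \<and> f i \<noteq> f j)"
  using assms(1,2)
proof (induction "card C" arbitrary: C)
  case 0
  then show ?case by simp
next
  case (Suc n)
  have "\<exists>x\<in>C. \<forall>y\<in>C. (y, x) \<in> r"
  proof -
    have "C \<noteq> {}" using Suc.hyps(2) by auto
    with \<open>finite C\<close> show ?thesis using Suc.prems(2)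
    proof (induction rule: finite_ne_induct)
      case (insert x F)
      then obtain y where y: "y \<in> F" "\<forall>z\<in>F. (z, y) \<in> r" by (auto simp: Chains_def)
      show ?case
      proof (cases "(x, y) \<in> r")
        case True
        with y show ?thesis by blast
      next
        case False
        then have "(y, x) \<in> r" "(x, x) \<in> r" using insert.prems y(1) by (auto simp: Chains_def)
        with y(2) show ?thesis using assms(3) by (blast dest: transD)
      qed
    qed (auto simp: Chains_def)
  qed
  then obtain x where x: "x \<in> C" "\<And>y. y \<in> C \<Longrightarrow> (y, x) \<in> r" by blast
  have n: "card (C - {x}) = n" using Suc.hyps(2) x(1) Suc.prems(1) by simp
  have "C - {x} \<in> Chains r" using Suc.prems(2) by (auto simp: Chains_def)
  with Suc.hyps(1)[of "C - {x}"] n Suc.prems(1) obtain f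
    where f: "f ` {..<n} = C - {x}" "\<forall>j<n. \<forall>i<j. (f i, f j) \<in> r \<and> f i \<noteq> f j" by auto
  have mem: "f i \<in> C \<and> f i \<noteq> x" if "i < n" for i using f(1) that by blast
  show ?case
  proof (intro exI[of _ "f(n := x)"] conjI allI impI)
    have "(f(n := x)) ` {..<card C} = insert x (f ` {..<n})"
      unfolding Suc.hyps(2)[symmetric] lessThan_Suc by auto
    with f(1) x(1) show "(f(n := x)) ` {..<card C} = C" by auto
    fix j i assume "j < card C" "i < j"
    then show "((f(n := x)) i, (f(n := x)) j) \<in> r" "(f(n := x)) i \<noteq> (f(n := x)) j"
      using f(2) mem x(2) Suc.hyps(2) by (cases "j = n"; auto)+
  qed
qed

text \<open>Conjugation by a transposition: \<open>a\<close> and \<open>c\<close> exchange their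
  positions in \<open>L\<close>.\<close>

definition swap_in :: "'a \<Rightarrow> 'a \<Rightarrow> 'a rel \<Rightarrow> 'a rel" where
  "swap_in a c L = {(p, q). (transpose a c p, transpose a c q) \<in> L}"

lemma swap_in_swap_in [simp]: "swap_in a c (swap_in a c L) = L"
  by (simp add: swap_in_def)

lemma inj_swap_in: "inj (swap_in a c)"
  by (rule inj_on_inverseI[where g = "swap_in a c"]) simp

lemma linear_order_on_swap_in:
  assumes "linear_order_on V L" "a \<in> V" "c \<in> V"
  shows "linear_order_on V (swap_in a c L)"
proof -
  have V: "transpose a c p \<in> V \<longleftrightarrow> p \<in> V" for p
    using assms(2,3) by (auto simp: transpose_def)
  have eq: "transpose a c p = transpose a c q \<longleftrightarrow> p = q" for p q
    by (metis transpose_involutory)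
  have L: "L \<subseteq> V \<times> V" "refl_on V L" "trans L" "antisym L" "total_on V L"
    using assms(1) by (auto simp: order_on_defs)
  show ?thesis
    unfolding order_on_defs
  proof (intro conjI)
    show "swap_in a c L \<subseteq> V \<times> V" using L(1) V by (auto simp: swap_in_def)
    show "refl_on V (swap_in a c L)" using L(2) V by (auto simp: swap_in_def refl_on_def)
    show "trans (swap_in a c L)" using L(3) unfolding swap_in_def trans_def by blast
    show "antisym (swap_in a c L)" using L(4) eq unfolding swap_in_def antisym_def by blast
    show "total_on V (swap_in a c L)" using L(5) eq V unfolding swap_in_def total_on_def by blast
  qed
qed

text \<open>\<open>a\<close> moves down to the place of \<open>c\<close>, which comes after all of
  \<open>D(a)\<close> because \<open>D(a) = D(b)\<close> and \<open>b\<close> is below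
  \<open>c\<close>. \<open>c\<close> moves up to the place of \<open>a\<close>; elements above
  \<open>c\<close> still follow, either because they are above \<open>a\<close> or by
  \<open>later\<close>.\<close>

lemma swap_in_linear_extension:
  assumes order: "partial_order_on V r"
    and L: "L \<in> linear_extensions V r"
    and V: "a \<in> V" "b \<in> V" and ne: "a \<noteq> b"
    and D: "underS r a = underS r b"
    and c: "c \<in> insert b (aboveS r b - aboveS r a)"
    and ca: "(c, a) \<in> L"
    and later: "\<And>q. q \<in> aboveS r b - aboveS r a \<Longrightarrow> (c, q) \<in> r \<Longrightarrow> q \<noteq> c \<Longrightarrow> (a, q) \<in> L"
  shows "swap_in a c L \<in> linear_extensions V r"
proof -
  have lin: "linear_order_on V L" and rL: "r \<subseteq> L" using L by (auto simp: linear_extensions_def)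
  have tL: "trans L" and refl_L: "\<And>p. p \<in> V \<Longrightarrow> (p, p) \<in> L"
    using lin by (auto simp: order_on_defs refl_on_def)
  have rV: "r \<subseteq> V \<times> V" and tr: "trans r" and an: "antisym r" and re: "\<And>p. p \<in> V \<Longrightarrow> (p, p) \<in> r"
    using order by (auto simp: order_on_defs refl_on_def)
  have ab: "(a, b) \<notin> r" and ba: "(b, a) \<notin> r" using D ne unfolding underS_def by blast+
  have bc: "(b, c) \<in> r" using c re V by (auto simp: aboveS_def)
  then have cV: "c \<in> V" using rV by blast
  have ac: "(a, c) \<notin> r" using c ab ba bc by (auto simp: aboveS_def)
  have ca_r: "(c, a) \<notin> r" using bc ba tr by (blast dest: transD)
  have neq: "a \<noteq> c" using bc ba by blast
  have "(p, q) \<in> swap_in a c L" if pq: "(p, q) \<in> r" for p q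
  proof -
    have pqL: "(p, q) \<in> L" using pq rL by blast
    consider "p = q" | "p \<noteq> q" "p = a" | "p \<noteq> q" "p = c" | "p \<noteq> q" "q = a" | "p \<noteq> q" "q = c" "p \<noteq> a"
      | "p \<noteq> a" "p \<noteq> c" "q \<noteq> a" "q \<noteq> c" by blast
    then show ?thesis
    proof cases
      case 1
      then have "transpose a c q \<in> V" using pq rV V cV by (auto simp: transpose_def)
      with 1 show ?thesis using refl_L by (simp add: swap_in_def)
    next
      case 2
      then have "q \<noteq> c" using pq ac by blast
      moreover have "(c, q) \<in> L" using ca pqL 2 tL by (blast dest: transD)
      ultimately show ?thesis using 2 by (simp add: swap_in_def transpose_def)
    next
      case 3
      then have "q \<noteq> a" using pq ca_r by blast
      have bq: "(b, q) \<in> r" using bc pq 3 tr by (blast dest: transD)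
      have "q \<noteq> b" using 3 pq bc an by (blast dest: antisymD)
      have "(a, q) \<in> L"
      proof (cases "(a, q) \<in> r")
        case True
        then show ?thesis using rL by blast
      next
        case False
        then show ?thesis using later[of q] bq \<open>q \<noteq> b\<close> pq 3 by (auto simp: aboveS_def)
      qed
      with 3 \<open>q \<noteq> a\<close> show ?thesis by (simp add: swap_in_def transpose_def)
    next
      case 4
      then have "p \<noteq> c" using pq ca_r by blast
      have "p \<in> underS r b" using 4 pq D unfolding underS_def by blast
      then have "(p, c) \<in> L" using bc tr rL unfolding underS_def by (blast dest: transD)
      with 4 \<open>p \<noteq> c\<close> show ?thesis by (simp add: swap_in_def transpose_def)
    next
      case 5
      then have "(p, a) \<in> L" using pqL ca tL by (blast dest: transD)
      with 5 neq show ?thesis by (simp add: swap_in_def transpose_def)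
    next
      case 6
      then show ?thesis using pqL by (simp add: swap_in_def transpose_def)
    qed
  qed
  then show ?thesis
    using linear_order_on_swap_in[OF lin V(1) cV] by (auto simp: linear_extensions_def)
qed

text \<open>If \<open>M 0\<close> is below a third of \<open>N\<close>, take the first
  \<open>i\<close> at which \<open>M i\<close> reaches a third. The preceding value and the
  increment are both less than a third, so \<open>M i\<close> is less than two thirds.\<close>

lemma ex_value_in_middle_third:
  fixes M :: "nat \<Rightarrow> nat"
  assumes "2 * M 0 \<le> N" "M n = N" "0 < N" "\<And>i. i < n \<Longrightarrow> M (Suc i) \<le> M i + M 0"
  shows "\<exists>i<n. N \<le> 3 * M i \<and> 3 * M i \<le> 2 * N"
proof (cases "N \<le> 3 * M 0")
  case True
  have "n \<noteq> 0"
  proof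
    assume "n = 0"
    with assms(1-3) show False by simp
  qed
  with True assms(1) show ?thesis by (intro exI[of _ 0]) auto
next
  case False
  define i where "i = (LEAST i. N \<le> 3 * M i)"
  have "N \<le> 3 * M n" using assms(2) by simp
  then have i: "N \<le> 3 * M i" "i \<le> n"
    unfolding i_def by (auto intro: LeastI Least_le)
  from False i(1) obtain j where j: "i = Suc j" by (cases i) auto
  have "\<not> N \<le> 3 * M j" using not_less_Least[of j "\<lambda>i. N \<le> 3 * M i"] j unfolding i_def by simp
  moreover have "M i \<le> M j + M 0" using assms(4)[of j] i(2) j by simp
  ultimately have "3 * M i < 2 * N" using False by linarith
  moreover from this have "i \<noteq> n" using assms(2) by auto
  ultimately show ?thesis using i by (intro exI[of _ i]) auto
qed

lemma ex_balanced_pair_if_before_le_half: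
  assumes fin: "finite V" and order: "partial_order_on V r"
    and V: "a \<in> V" "b \<in> V" and ne: "a \<noteq> b"
    and D: "underS r a = underS r b"
    and chain: "aboveS r b - aboveS r a \<in> Chains r"
    and half: "2 * card {L \<in> linear_extensions V r. (a, b) \<in> L} \<le> card (linear_extensions V r)"
  shows "\<exists>x y. balanced_pair V r x y"
proof -
  define E where "E = linear_extensions V r"
  have finE: "finite E" and E0: "0 < card E"
    using finite_linear_extensions[OF fin, of r] ex_linear_extension[OF fin order]
    by (auto simp: E_def card_gt_0_iff)
  have rV: "r \<subseteq> V \<times> V" and tr: "trans r" and an: "antisym r" and re: "\<And>p. p \<in> V \<Longrightarrow> (p, p) \<in> r"
    using order by (auto simp: order_on_defs refl_on_def)
  define C where "C = insert b (aboveS r b - aboveS r a)"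
  have bC: "(b, q) \<in> r" if "q \<in> C" for q using that re V by (auto simp: C_def aboveS_def)
  have CV: "C \<subseteq> V" using bC rV by blast
  have "C \<in> Chains r"
  proof (rule ChainsI)
    fix p q assume pq: "p \<in> C" "q \<in> C"
    show "(p, q) \<in> r \<or> (q, p) \<in> r"
    proof (cases "p = b \<or> q = b")
      case True
      then show ?thesis using bC pq by blast
    next
      case False
      then show ?thesis using pq chain unfolding C_def by (auto simp: Chains_def)
    qed
  qed
  moreover have finC: "finite C" using CV fin finite_subset by blast
  ultimately obtain f where f_im: "f ` {..<card C} = C"
    and f: "\<And>i j. j < card C \<Longrightarrow> i < j \<Longrightarrow> (f i, f j) \<in> r \<and> f i \<noteq> f j"
    using Chains_enumeration[OF _ _ tr an] by metis
  define n where "n = card C"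
  have fC: "f i \<in> C" if "i < n" for i using f_im that unfolding n_def by blast
  have n0: "0 < n" using finC by (auto simp: n_def C_def card_gt_0_iff)
  have f0: "f 0 = b"
  proof (rule ccontr)
    assume f0: "f 0 \<noteq> b"
    obtain j where j: "j < n" "f j = b" using f_im by (force simp: n_def C_def)
    then have "(f 0, b) \<in> r" using f[of j 0] f0 by (cases j) (auto simp: n_def)
    then show False using bC[OF fC[OF n0]] f0 an by (blast dest: antisymD)
  qed
  have ba: "(b, a) \<notin> r" using D ne unfolding underS_def by blast
  have aC: "a \<notin> C" using bC ba by blast
  \<comment> \<open>The value at \<open>n\<close> acts as if \<open>f n\<close> lay above
    everything, so that the last gap, with \<open>a\<close> after the whole chain, is counted as
    well.\<close>
  define A where "A i = (if i < n then {L \<in> E. (a, f i) \<in> L} else E)" for i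
  have finA: "finite (A i)" for i using finE by (simp add: A_def)
  have LE: "linear_order_on V L" "r \<subseteq> L" if "L \<in> E" for L
    using that by (auto simp: E_def linear_extensions_def)
  have LD: "trans L" "antisym L" if "L \<in> E" for L using LE(1)[OF that] by (auto simp: order_on_defs)
  have before_if: "(f i, a) \<in> L" if "L \<in> E" "L \<notin> A i" "i < n" for i L
  proof -
    have "f i \<in> V" "f i \<noteq> a" using fC[OF that(3)] CV aC by auto
    then show ?thesis
      using LE(1)[OF that(1)] that V by (auto simp: A_def order_on_defs total_on_def)
  qed
  have not_before: "L \<notin> A i" if "L \<in> E" "(f i, a) \<in> L" "i < n" for i L
    using that aC fC[OF that(3)] antisymD[OF LD(2)[OF that(1)] that(2)] by (auto simp: A_def)
  have mono: "A i \<subseteq> A (Suc i)" if "i < n" for i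
  proof
    fix L assume L: "L \<in> A i"
    then have LE': "L \<in> E" using that by (simp add: A_def)
    show "L \<in> A (Suc i)"
    proof (cases "Suc i < n")
      case True
      then have "(f i, f (Suc i)) \<in> L" using f[of "Suc i" i] LE(2)[OF LE'] by (auto simp: n_def)
      then have "(a, f (Suc i)) \<in> L"
        using L that LD(1)[OF LE'] by (auto simp: A_def dest: transD)
      then show ?thesis using LE' True by (simp add: A_def)
    qed (use LE' in \<open>simp add: A_def\<close>)
  qed
  \<comment> \<open>In \<open>L\<close>, the element \<open>a\<close> falls between
    \<open>f i\<close> and \<open>f (Suc i)\<close>; after the exchange it falls between
    \<open>f (i - 1)\<close> and \<open>f i\<close>. For \<open>i = 0\<close> truncated subtraction
    gives no predecessor, hence the guard.\<close>
  have swap: "swap_in a (f i) L \<in> A i \<and> (0 < i \<longrightarrow> swap_in a (f i) L \<notin> A (i - 1))"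
    if i: "i < n" and L: "L \<in> A (Suc i) - A i" for i L
  proof -
    from L have LE': "L \<in> E" by (auto simp: A_def split: if_splits)
    have ca: "(f i, a) \<in> L" using before_if[OF LE' _ i] L by blast
    have "swap_in a (f i) L \<in> linear_extensions V r"
    proof (rule swap_in_linear_extension[OF order _ V ne D _ ca])
      show "L \<in> linear_extensions V r" using LE' by (simp add: E_def)
      show "f i \<in> insert b (aboveS r b - aboveS r a)" using fC[OF i] by (simp add: C_def)
      fix q assume q: "q \<in> aboveS r b - aboveS r a" "(f i, q) \<in> r" "q \<noteq> f i"
      then have "q \<in> C" by (simp add: C_def)
      then obtain j where j: "j < n" "q = f j" using f_im by (auto simp: n_def)
      have "\<not> j < i" using f[of i j] i j q antisymD[OF an] by (auto simp: n_def)
      with q(3) j have ij: "i < j" by (metis linorder_neqE_nat)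
      then have "Suc i < n" using j by simp
      then have aSi: "(a, f (Suc i)) \<in> L" using L by (auto simp: A_def)
      show "(a, q) \<in> L"
      proof (cases "j = Suc i")
        case True
        with aSi j show ?thesis by simp
      next
        case False
        then have "(f (Suc i), f j) \<in> L" using f[of j "Suc i"] ij j LE(2)[OF LE'] by (auto simp: n_def)
        with aSi j show ?thesis using LD(1)[OF LE'] by (blast dest: transD)
      qed
    qed
    then have sE: "swap_in a (f i) L \<in> E" by (simp add: E_def)
    have "(a, f i) \<in> swap_in a (f i) L" using ca by (simp add: swap_in_def)
    then have 1: "swap_in a (f i) L \<in> A i" using sE i by (simp add: A_def)
    have "swap_in a (f i) L \<notin> A (i - 1)" if "0 < i"
    proof (rule not_before[OF sE])
      have "(f (i - 1), f i) \<in> L" "f (i - 1) \<noteq> f i"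
        using f[of i "i - 1"] i that LE(2)[OF LE'] by (auto simp: n_def)
      moreover have "f (i - 1) \<noteq> a" using aC fC[of "i - 1"] i by auto
      ultimately show "(f (i - 1), a) \<in> swap_in a (f i) L"
        by (simp add: swap_in_def transpose_def)
    qed (use i in simp)
    with 1 show ?thesis by blast
  qed
  \<comment> \<open>Exchanging is injective, so each gap is at most as large as the one before it,
    and the first is at most \<open>card (A 0)\<close>.\<close>
  have decreasing: "card (A (Suc i) - A i) \<le> card (A 0)" if "i < n" for i
    using that
  proof (induction i)
    case 0
    show ?case
    proof (rule card_inj_on_le[where f = "swap_in a (f 0)"])
      show "swap_in a (f 0) ` (A (Suc 0) - A 0) \<subseteq> A 0" using swap[OF 0] by blast
    qed (use finA inj_on_subset[OF inj_swap_in] in auto)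
  next
    case (Suc i)
    have "card (A (Suc (Suc i)) - A (Suc i)) \<le> card (A (Suc i) - A i)"
    proof (rule card_inj_on_le[where f = "swap_in a (f (Suc i))"])
      show "swap_in a (f (Suc i)) ` (A (Suc (Suc i)) - A (Suc i)) \<subseteq> A (Suc i) - A i"
        using swap[OF Suc.prems] by auto
    qed (use finA inj_on_subset[OF inj_swap_in] in auto)
    with Suc show ?case by simp
  qed
  have "\<exists>i<n. card E \<le> 3 * card (A i) \<and> 3 * card (A i) \<le> 2 * card E"
  proof (rule ex_value_in_middle_third)
    show "2 * card (A 0) \<le> card E" using half n0 f0 by (simp add: A_def E_def)
    show "card (A n) = card E" by (simp add: A_def)
    show "card (A (Suc i)) \<le> card (A i) + card (A 0)" if i: "i < n" for i
    proof -
      have "card (A (Suc i)) = card (A i) + card (A (Suc i) - A i)"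
        using mono[OF i] finA by (metis add_diff_inverse_nat card_Diff_subset card_mono not_less)
      with decreasing[OF i] show ?thesis by simp
    qed
  qed (use E0 in simp)
  then obtain i where i: "i < n" "card E \<le> 3 * card (A i)" "3 * card (A i) \<le> 2 * card E" by blast
  have ne': "a \<noteq> f i" using fC[OF i(1)] aC by auto
  then have "{L \<in> E. (a, f i) \<in> L - Id} = A i" using i(1) by (auto simp: A_def)
  then have prob: "prob_before V r a (f i) = real (card (A i)) / real (card E)"
    by (simp add: prob_before_def E_def)
  have "real (card E) \<le> 3 * real (card (A i))" "3 * real (card (A i)) \<le> 2 * real (card E)"
    using i(2,3) by linarith+
  then have "1 / 3 \<le> prob_before V r a (f i)" "prob_before V r a (f i) \<le> 2 / 3"
    unfolding prob using E0 by (simp_all add: field_simps)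
  then have "balanced_pair V r a (f i)"
    using ne' V fC[OF i(1)] CV by (auto simp: balanced_pair_def)
  then show ?thesis by blast
qed

section \<open>Reversal of linear extensions and the choice of orientation\<close>

lemma linear_extensions_converse: "linear_extensions V (r\<inverse>) = converse ` linear_extensions V r"
proof -
  have "L \<in> converse ` linear_extensions V r" if "L \<in> linear_extensions V (r\<inverse>)" for L
    using that by (intro image_eqI[of _ _ "L\<inverse>"]) (auto simp: linear_extensions_def)
  then show ?thesis by (auto simp: linear_extensions_def)
qed

lemma prob_before_converse: "prob_before V (r\<inverse>) x y = prob_before V r y x"
proof -
  have inj: "inj_on converse S" for S :: "'a rel set" by (rule inj_onI) simp
  have "{L \<in> linear_extensions V (r\<inverse>). (x, y) \<in> L - Id} =
      converse ` {L \<in> linear_extensions V r. (y, x) \<in> L - Id}"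
    unfolding linear_extensions_converse by auto
  then show ?thesis
    unfolding prob_before_def by (simp only: linear_extensions_converse card_image[OF inj])
qed

text \<open>The events that \<open>a\<close> precedes \<open>b\<close> and that \<open>b\<close>
  precedes \<open>a\<close> are disjoint, so one of them has at most half of the extensions; the
  condition is symmetric in \<open>a\<close> and \<open>b\<close>.\<close>

lemma ex_balanced_pair_if_very_good_in:
  assumes fin: "finite V" and order: "partial_order_on V r"
    and V: "a \<in> V" "b \<in> V" and ne: "a \<noteq> b" and vg: "very_good_in r a b"
  shows "\<exists>x y. balanced_pair V r x y"
proof -
  define E where "E = linear_extensions V r"
  have finE: "finite E" using finite_linear_extensions[OF fin] by (simp add: E_def)
  have "{L \<in> E. (a, b) \<in> L} \<inter> {L \<in> E. (b, a) \<in> L} = {}"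
    using ne by (auto simp: E_def linear_extensions_def order_on_defs antisym_def)
  then have "card {L \<in> E. (a, b) \<in> L} + card {L \<in> E. (b, a) \<in> L} \<le> card E"
    using finE by (subst card_Un_disjoint[symmetric]) (auto intro!: card_mono)
  then consider "2 * card {L \<in> E. (a, b) \<in> L} \<le> card E" | "2 * card {L \<in> E. (b, a) \<in> L} \<le> card E"
    by linarith
  then show ?thesis
  proof cases
    case 1
    then show ?thesis
      using ex_balanced_pair_if_before_le_half[OF fin order V ne] vg by (auto simp: very_good_in_def E_def)
  next
    case 2
    then show ?thesis
      using ex_balanced_pair_if_before_le_half[OF fin order V(2,1) ne[symmetric]] vg
      by (auto simp: very_good_in_def E_def)
  qed
qed

lemma ex_balanced_pair_if_very_good_pair:
  assumes fin: "finite V" and order: "partial_order_on V r" and vg: "very_good_pair V r a b"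
  shows "\<exists>x y. balanced_pair V r x y"
proof -
  from vg consider "very_good_in r a b" | "very_good_in (r\<inverse>) a b"
    by (auto simp: very_good_pair_def)
  then show ?thesis
  proof cases
    case 1
    with vg show ?thesis
      using ex_balanced_pair_if_very_good_in[OF fin order] by (auto simp: very_good_pair_def)
  next
    case 2
    have "partial_order_on V (r\<inverse>)" using order by simp
    from ex_balanced_pair_if_very_good_in[OF fin this _ _ _ 2] vg
    obtain x y where "balanced_pair V (r\<inverse>) x y" by (auto simp: very_good_pair_def)
    then have "balanced_pair V r y x" by (auto simp: balanced_pair_def prob_before_converse)
    then show ?thesis by blast
  qed
qed

theorem theorem3:
  fixes V :: "'a set" and r :: "'a rel"
  assumes "finite V"
    and "partial_order_on V r"
    and "\<not> linear_order_on V r"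
    and "forest V (cover_edges V r)"
  shows "(\<exists>a b. very_good_pair V r a b) \<and> (\<exists>x y. balanced_pair V r x y)"
  using ex_very_good_pair[OF assms] ex_balanced_pair_if_very_good_pair[OF assms(1,2)] by blast

end
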